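(* The class of free orderings of the class $\mathcal D$ of all finite diversities is a Ramsey class.
   Context: A diversity is a set $A$ with a function $d$ from the finite subsets of $A$ to $\mathbb R^{\ge 0}$ such that for all finite $X,Y,Z\subseteq A$: $d(X)=0$ iff $|X|\le 1$, and if $Y\neq\emptyset$ then $d(X\cup Y)+d(Y\cup Z)\ge d(X\cup Z)$. A diversity is viewed as a relational structure in the language $L$ with an $n$-ary relation symbol $R_{n,r}$ for every integer $n\ge2$ and $r\in\mathbb R^{>0}$, holding exactly on the $n$-tuples of pairwise distinct elements whose underlying set $X$ has $d(X)=r$. The class of free orderings of $\mathcal D$ consists of all structures in $L\cup\{<\}$ ($<$ binary) in which $<$ is a linear order of the vertex set and whose $L$-reduct is in $\mathcal D$. A class $\mathcal C$ of finite structures is Ramsey if for all $\mathbf A,\mathbf B\in\mathcal C$ there is $\mathbf C\in\mathcal C$ such that for every colouring $\chi\colon\mathrm{Emb}(\mathbf A,\mathbf C)\to\{0,1\}$ there is an embedding $f\colon\mathbf B\to\mathbf C$ with $\chi$ constant on $\{f\circ e:e\in\mathrm{Emb}(\mathbf A,\mathbf B)\}$. *)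

theory Defs
  imports Complex_Main "HOL-Library.FuncSet" "HOL-Library.Infinite_Typeclass"
begin

record 's language =
  symbols :: "'s set"
  arity :: "'s \<Rightarrow> nat"

record ('s, 'a) rel_structure =
  verts :: "'a set"
  interp :: "'s \<Rightarrow> 'a list set"

text \<open>
  Values of \<open>interp\<close> outside the language are normalised to the empty set, so that
  equality of HOL records is equality of structures.
\<close>

definition is_structure :: "'s language \<Rightarrow> ('s, 'a) rel_structure \<Rightarrow> bool" where
  "is_structure L S \<longleftrightarrow>
     (\<forall>s\<in>symbols L. interp S s \<subseteq> {xs. length xs = arity L s \<and> set xs \<subseteq> verts S}) \<and>
     (\<forall>s. s \<notin> symbols L \<longrightarrow> interp S s = {})"

text \<open>
  Embeddings are extensional functions, so that two of them are equal iff they agree on the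
  vertex set of the source.  Composites are accordingly formed with \<^const>\<open>compose\<close>.
\<close>

definition Emb ::
  "'s language \<Rightarrow> ('s, 'a) rel_structure \<Rightarrow> ('s, 'b) rel_structure \<Rightarrow> ('a \<Rightarrow> 'b) set" where
  "Emb L A B =
     {f \<in> verts A \<rightarrow>\<^sub>E verts B. inj_on f (verts A) \<and>
        (\<forall>s\<in>symbols L. \<forall>xs. length xs = arity L s \<and> set xs \<subseteq> verts A \<longrightarrow>
           (xs \<in> interp A s \<longleftrightarrow> map f xs \<in> interp B s))}"

definition ramsey_class :: "'s language \<Rightarrow> ('s, 'a) rel_structure set \<Rightarrow> bool" where
  "ramsey_class L K \<longleftrightarrow>
     (\<forall>A\<in>K. is_structure L A \<and> finite (verts A)) \<and>
     (\<forall>A\<in>K. \<forall>B\<in>K. \<exists>C\<in>K. \<forall>\<chi> \<in> Emb L A C \<rightarrow> {0, 1::nat}.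
        \<exists>f\<in>Emb L B C. \<exists>c. \<forall>e\<in>Emb L A B. \<chi> (compose (verts A) f e) = c)"

datatype 's ord_symbol = Base 's | Less

definition ord_language :: "'s language \<Rightarrow> 's ord_symbol language" where
  "ord_language L =
     \<lparr>symbols = insert Less (Base ` symbols L),
      arity = (\<lambda>s. case s of Base t \<Rightarrow> arity L t | Less \<Rightarrow> 2)\<rparr>"

definition reduct :: "('s ord_symbol, 'a) rel_structure \<Rightarrow> ('s, 'a) rel_structure" where
  "reduct S = \<lparr>verts = verts S, interp = (\<lambda>s. interp S (Base s))\<rparr>"

definition free_orderings ::
  "'s language \<Rightarrow> ('s, 'a) rel_structure set \<Rightarrow> ('s ord_symbol, 'a) rel_structure set" where
  "free_orderings L K =
     {S. is_structure (ord_language L) S \<and>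
         strict_linear_order_on (verts S) {(x, y). [x, y] \<in> interp S Less} \<and>
         reduct S \<in> K}"

text \<open>Only the values of \<open>d\<close> on finite subsets of \<open>A\<close> are relevant.\<close>

definition diversity :: "'a set \<Rightarrow> ('a set \<Rightarrow> real) \<Rightarrow> bool" where
  "diversity A d \<longleftrightarrow>
     (\<forall>X. finite X \<and> X \<subseteq> A \<longrightarrow> d X \<ge> 0 \<and> (d X = 0 \<longleftrightarrow> card X \<le> 1)) \<and>
     (\<forall>X Y Z. finite X \<and> X \<subseteq> A \<and> finite Y \<and> Y \<subseteq> A \<and> finite Z \<and> Z \<subseteq> A \<and> Y \<noteq> {} \<longrightarrow>
        d (X \<union> Y) + d (Y \<union> Z) \<ge> d (X \<union> Z))"

text \<open>The pair \<open>(n, r)\<close> is the \<open>n\<close>-ary symbol \<open>R\<^bsub>n,r\<^esub>\<close>.\<close>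

definition div_language :: "(nat \<times> real) language" where
  "div_language = \<lparr>symbols = {(n, r). n \<ge> 2 \<and> r > 0}, arity = fst\<rparr>"

definition div_structure :: "'a set \<Rightarrow> ('a set \<Rightarrow> real) \<Rightarrow> (nat \<times> real, 'a) rel_structure" where
  "div_structure A d =
     \<lparr>verts = A,
      interp = (\<lambda>(n, r). if n \<ge> 2 \<and> r > 0
        then {xs. length xs = n \<and> distinct xs \<and> set xs \<subseteq> A \<and> d (set xs) = r} else {})\<rparr>"

definition finite_diversities :: "(nat \<times> real, 'a) rel_structure set" where
  "finite_diversities = {div_structure A d | A d. finite A \<and> diversity A d}"

end

theory Submission
  imports Defs "HOL-Library.Product_Lexorder"
begin

text \<open>
  Let \<open>E\<close> be the vertex set of \<open>B\<close>.  The subadditive functions on the subsets of \<open>E\<close> with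
  values in a suitable finite set form a finite diversity \<open>Q\<close> that is injective for the
  diversities embedding into \<open>B\<close>: every non-expansive map (pattern) from \<open>A\<close> to
  \<open>Q\<close> extends along every embedding of \<open>A\<close> into \<open>B\<close>.  Words over \<open>Q\<close> carry the
  coordinatewise supremum diversity and a lexicographic order.  A rigid surjection from the
  coordinates onto the patterns on \<open>A\<close> turns every point of \<open>A\<close> into a word, and this is
  an embedding, since some pattern is isometric (Kuratowski's \<open>C \<mapsto> d (C \<union> {a})\<close>).  For
  a suitable order of the patterns, restricting the patterns on \<open>B\<close> along an embedding
  \<open>A \<rightarrow> B\<close> is itself a rigid surjection onto the patterns on \<open>A\<close>.  Therefore the dual
  Ramsey theorem of Graham and Rothschild, which follows from the Hales--Jewett theorem, carries
  over to ordered diversities.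
\<close>

text \<open>The dual Ramsey theorem does not control which rigid surjection it returns, so every
  rigid surjection must yield an order-preserving isometry. For distances it suffices that the
  coordinates run through all patterns. For the order, the first coordinate separating two points
  has to favour the smaller one: the largest function is made the first letter of the alphabet, and
  patterns that are maximal at all points but one force it to be the letter of the smaller point
  there. Such a pattern is non-expansive because the two largest values \<open>M'\<close> and
  \<open>M\<close> differ by no more than any nonzero diversity of a subset of \<open>E\<close>;
  this governs the choice of the value set. Rigidity of the restriction map requires that a pattern
  on \<open>A\<close> be reached before any later one is. The order prefers larger values, so the
  pointwise largest extension is the early witness; comparing small values before all larger ones
  keeps the values at new points from upsetting a comparison made on \<open>A\<close>.\<close>

section \<open>Parameter words and the Graham--Rothschild theorem\<close>

text \<open>
  The letters below \<open>a\<close> count as already seen; a word may introduce new letters only in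
  increasing order, and \<open>b\<close> is the number of letters seen at its end.  So the words with
  \<open>param_word t w (t + m)\<close> are the \<open>m\<close>-parameter words over the alphabet
  \<open>{..<t}\<close>, parameter \<open>i\<close> being the letter \<open>t + i\<close>, and for \<open>t = 0\<close> they are
  the rigid surjections onto \<open>{..<m}\<close>.
\<close>

primrec param_word :: "nat \<Rightarrow> nat list \<Rightarrow> nat \<Rightarrow> bool" where
  "param_word a [] b \<longleftrightarrow> a = b"
| "param_word a (c # w) b \<longleftrightarrow> (if c < a then param_word a w b else c = a \<and> param_word (Suc a) w b)"

text \<open>Composition of parameter words; for \<open>t = 0\<close> it is the composition
  \<open>u \<circ> w\<close> of surjections.\<close>

definition subst :: "nat \<Rightarrow> nat list \<Rightarrow> nat list \<Rightarrow> nat list" where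
  "subst t u w = map (\<lambda>c. if c < t then c else u ! (c - t)) w"

lemma subst_simps [simp]:
  "subst t u [] = []"
  "subst t u (c # w) = (if c < t then c else u ! (c - t)) # subst t u w"
  "subst t u (v @ w) = subst t u v @ subst t u w"
  "length (subst t u w) = length w"
  by (simp_all add: subst_def)

lemma param_word_append:
  "param_word a (u @ v) c \<longleftrightarrow> (\<exists>b. param_word a u b \<and> param_word b v c)"
  by (induction u arbitrary: a) auto

lemma param_word_fun: "param_word a w b \<Longrightarrow> param_word a w b' \<Longrightarrow> b = b'"
  by (induction w arbitrary: a) (auto split: if_splits)

lemma param_word_le: "param_word a w b \<Longrightarrow> a \<le> b"
  by (induction w arbitrary: a) (auto split: if_splits dest: Suc_leD)

lemma param_word_set: "param_word a w b \<Longrightarrow> set w \<subseteq> {..<b}"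
proof (induction w arbitrary: a)
  case (Cons c w)
  then show ?case using param_word_le[of a w b] param_word_le[of "Suc a" w b]
    by (auto split: if_splits)
qed simp

lemma param_word_const: "param_word a w a \<longleftrightarrow> set w \<subseteq> {..<a}"
  by (induction w) (auto dest: param_word_le)

lemma param_word_upt: "a \<le> b \<Longrightarrow> param_word a [a..<b] b"
proof (induction b)
  case (Suc b)
  then show ?case by (cases "a = Suc b") (auto simp: param_word_append)
qed simp

lemma param_word_first:
  "param_word a w b \<Longrightarrow> a \<le> c \<Longrightarrow> c < b \<Longrightarrow>
   \<exists>pre post. w = pre @ c # post \<and> param_word a pre c \<and> param_word (Suc c) post b"
proof (induction w arbitrary: a)
  case (Cons x w)
  show ?case
  proof (cases "a = c \<and> x = a")
    case True
    then show ?thesis using Cons.prems by (intro exI[of _ "[]"] exI[of _ w]) auto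
  next
    case False
    then have "\<exists>a'. param_word a' w b \<and> a' \<le> c \<and> (if x < a then a' = a else x = a \<and> a' = Suc a)"
      using Cons.prems by (auto split: if_splits)
    then obtain a' where a': "param_word a' w b" "a' \<le> c"
      "if x < a then a' = a else x = a \<and> a' = Suc a" by blast
    from Cons.IH[OF a'(1,2) Cons.prems(3)] obtain pre post
      where "w = pre @ c # post" "param_word a' pre c" "param_word (Suc c) post b" by blast
    then show ?thesis using a' by (intro exI[of _ "x # pre"] exI[of _ post]) (auto split: if_splits)
  qed
qed simp

text \<open>Makes room for \<open>s\<close> letters behind the first \<open>t\<close>, so that a
  constant can be added to the alphabet or parameters can be inserted.\<close>

lemma param_word_shift:
  "param_word a v b \<Longrightarrow> t \<le> a \<Longrightarrow>
   param_word (a + s) (map (\<lambda>c. if c < t then c else c + s) v) (b + s)"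
proof (induction v arbitrary: a)
  case (Cons c v)
  then show ?case using Cons.IH[of a] Cons.IH[of "Suc a"] by (auto split: if_splits)
qed simp

lemma subst_cong:
  assumes "set w \<subseteq> {..<t + m}" "\<And>i. i < m \<Longrightarrow> u ! i = u' ! i"
  shows "subst t u w = subst t u' w"
  using assms unfolding subst_def by (intro map_cong) (auto simp: subset_iff less_diff_conv2)

lemma subst_append_left:
  assumes "param_word t w (t + length u)"
  shows "subst t (u @ v) w = subst t u w"
  by (rule subst_cong[OF param_word_set[OF assms]]) (simp add: nth_append)

text \<open>Associativity of composition; the hypothesis keeps the indices into \<open>u\<close> in
  range, outside of which \<open>!\<close> is unspecified.\<close>

lemma subst_subst:
  assumes "param_word t w (t + length u)"
  shows "subst t x (subst t u w) = subst t (subst t x u) w"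
proof -
  have "c < t + length u" if "c \<in> set w" for c
    using param_word_set[OF assms] that by auto
  then have "c - t < length u" if "c \<in> set w" "\<not> c < t" for c
    using that by (simp add: less_diff_conv2 add.commute)
  then show ?thesis unfolding subst_def by (auto simp: o_def)
qed

text \<open>The state in the middle of the word: \<open>a - t\<close> parameters have been used, so
  the letters substituted so far come from \<open>take (a - t) u\<close>, and \<open>b\<close> is
  the number of letters seen by then.\<close>

lemma param_word_subst_aux:
  "param_word a w (t + length u) \<Longrightarrow> t \<le> a \<Longrightarrow> param_word t u k \<Longrightarrow>
   param_word t (take (a - t) u) b \<Longrightarrow> param_word b (subst t u w) k"
proof (induction w arbitrary: a b)
  case Nil
  then show ?case by (auto dest: param_word_fun)
next
  case (Cons c w)
  have a: "a \<le> t + length u" using param_word_le[OF Cons.prems(1)] .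
  show ?case
  proof (cases "c < a")
    case True
    have "(if c < t then c else u ! (c - t)) < b"
    proof (cases "c < t")
      case True
      then show ?thesis using param_word_le[OF Cons.prems(4)] by simp
    next
      case False
      have "take (a - t) u ! (c - t) \<in> set (take (a - t) u)"
        using False True a by (intro nth_mem) auto
      then show ?thesis using False True a param_word_set[OF Cons.prems(4)] by auto
    qed
    moreover have "param_word b (subst t u w) k"
      using Cons.IH[of a b] Cons.prems True by auto
    ultimately show ?thesis by simp
  next
    case False
    then have c: "c = a" and w: "param_word (Suc a) w (t + length u)" using Cons.prems by auto
    have lt: "a - t < length u" using param_word_le[OF w] Cons.prems(2) by simp
    have s: "take (Suc a - t) u = take (a - t) u @ [u ! (a - t)]"
      using lt Cons.prems(2) by (simp add: Suc_diff_le take_Suc_conv_app_nth)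
    have "u = take (a - t) u @ u ! (a - t) # drop (Suc (a - t)) u"
      using lt by (rule id_take_nth_drop)
    then have "param_word t (take (a - t) u @ u ! (a - t) # drop (Suc (a - t)) u) k"
      using Cons.prems(3) by simp
    then have "param_word b (u ! (a - t) # drop (Suc (a - t)) u) k"
      using param_word_fun[OF Cons.prems(4)] unfolding param_word_append by blast
    then obtain b' where b': "if u ! (a - t) < b then b' = b else u ! (a - t) = b \<and> b' = Suc b"
      by (auto split: if_splits)
    have "param_word t (take (Suc a - t) u) b'"
      unfolding s param_word_append using Cons.prems(4) b' by (intro exI[of _ b]) auto
    then have "param_word b' (subst t u w) k" using Cons.IH[OF w] Cons.prems by simp
    then show ?thesis using b' c Cons.prems(2) by (auto split: if_splits)
  qed
qed

lemma param_word_subst: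
  assumes "param_word t w (t + length u)" "param_word t u k"
  shows "param_word t (subst t u w) k"
  using param_word_subst_aux[OF assms(1) _ assms(2), of t] by simp

lemma subst_upt: "p \<le> length u \<Longrightarrow> subst t u [t..<t + p] = take p u"
  by (rule nth_equalityI) (auto simp: subst_def)

section \<open>Shelah's proof of the Hales-Jewett theorem\<close>

text \<open>For each \<open>z\<close> the finite vector of the colours \<open>\<chi> x z\<close>
  with \<open>x \<in> X\<close> is encoded as a single colour; \<open>R\<close> comes from the
  number of such vectors.\<close>

lemma product_colouring:
  fixes r :: nat
  assumes "finite X"
  shows "\<exists>R::nat. \<forall>\<chi> :: 'x \<Rightarrow> 'z \<Rightarrow> nat. (\<forall>x z. \<chi> x z \<le> r) \<longrightarrow>
    (\<exists>\<psi>. (\<forall>z. \<psi> z \<le> R) \<and> (\<forall>z z'. \<psi> z = \<psi> z' \<longrightarrow> (\<forall>x\<in>X. \<chi> x z = \<chi> x z')))"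
proof -
  define F where "F = (X \<rightarrow>\<^sub>E {..r})"
  have "finite F" unfolding F_def using assms by (intro finite_PiE) auto
  then obtain h where h: "bij_betw h F {0..<card F}" using ex_bij_betw_finite_nat by blast
  show ?thesis
  proof (intro exI[of _ "card F"] allI impI)
    fix \<chi> :: "'x \<Rightarrow> 'z \<Rightarrow> nat" assume b: "\<forall>x z. \<chi> x z \<le> r"
    define \<psi> where "\<psi> z = h (restrict (\<lambda>x. \<chi> x z) X)" for z
    have mem: "restrict (\<lambda>x. \<chi> x z) X \<in> F" for z using b by (auto simp: F_def)
    have "\<psi> z \<le> card F" for z
      using bij_betwE[OF h] mem[of z] unfolding \<psi>_def by (auto intro: less_imp_le)
    moreover have "\<forall>x\<in>X. \<chi> x z = \<chi> x z'" if "\<psi> z = \<psi> z'" for z z'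
    proof -
      have "restrict (\<lambda>x. \<chi> x z) X = restrict (\<lambda>x. \<chi> x z') X"
        using that h mem unfolding \<psi>_def by (meson bij_betw_def inj_onD)
      then show ?thesis by (metis restrict_apply')
    qed
    ultimately show "\<exists>\<psi>. (\<forall>z. \<psi> z \<le> card F) \<and> (\<forall>z z'. \<psi> z = \<psi> z' \<longrightarrow> (\<forall>x\<in>X. \<chi> x z = \<chi> x z'))"
      by blast
  qed
qed

lemma finite_words: "finite {x. length x = n \<and> set x \<subseteq> {..<t::nat}}"
  using finite_lists_length_eq[of "{..<t}" n] by (simp add: conj_commute)

text \<open>
  Shelah's argument: among the words \<open>0\<^sup>p b\<^sup>H\<^sup>-\<^sup>p\<close> two, with \<open>p < q\<close>, induce the
  same colouring of the remaining coordinates; the letters in between become the new parameter.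
\<close>

lemma shelah_insensitivity:
  assumes b: "b < T"
  shows "\<exists>N. \<forall>\<chi> :: nat list \<Rightarrow> nat. (\<forall>x. \<chi> x \<le> r) \<longrightarrow>
    (\<exists>w. length w = N \<and> param_word T w (T + n) \<and>
      (\<forall>u u'. length u = n \<and> length u' = n \<and> set u \<subseteq> {..<T} \<and> set u' \<subseteq> {..<T} \<and>
         map (\<lambda>c. if c = b then 0 else c) u = map (\<lambda>c. if c = b then 0 else c) u' \<longrightarrow>
         \<chi> (subst T u w) = \<chi> (subst T u' w)))"
proof (induction n arbitrary: r)
  case 0
  show ?case by (rule exI[of _ 0]) simp
next
  case (Suc n)
  let ?f = "\<lambda>c. if c = b then 0 else c"
  \<comment> \<open>Colours are merged twice: \<open>R1\<close> accounts for all letters that may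
    fill the last block, \<open>R2\<close> for all words that may stand in front of it.\<close>
  obtain R1 :: nat where R1: "\<forall>\<chi> :: nat \<Rightarrow> nat list \<Rightarrow> nat. (\<forall>x z. \<chi> x z \<le> r) \<longrightarrow>
    (\<exists>\<psi>. (\<forall>z. \<psi> z \<le> R1) \<and> (\<forall>z z'. \<psi> z = \<psi> z' \<longrightarrow> (\<forall>x\<in>{..<T}. \<chi> x z = \<chi> x z')))"
    using product_colouring[where 'z = "nat list", OF finite_lessThan[of T], of r] by blast
  from Suc.IH[of R1] obtain N where N: "\<forall>\<chi> :: nat list \<Rightarrow> nat. (\<forall>x. \<chi> x \<le> R1) \<longrightarrow>
    (\<exists>w. length w = N \<and> param_word T w (T + n) \<and>
      (\<forall>u u'. length u = n \<and> length u' = n \<and> set u \<subseteq> {..<T} \<and> set u' \<subseteq> {..<T} \<and>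
         map ?f u = map ?f u' \<longrightarrow> \<chi> (subst T u w) = \<chi> (subst T u' w)))" by blast
  let ?X = "{x. length x = N \<and> set x \<subseteq> {..<T}}"
  obtain R2 :: nat where R2: "\<forall>\<chi> :: nat list \<Rightarrow> nat list \<Rightarrow> nat. (\<forall>x z. \<chi> x z \<le> r) \<longrightarrow>
    (\<exists>\<psi>. (\<forall>z. \<psi> z \<le> R2) \<and> (\<forall>z z'. \<psi> z = \<psi> z' \<longrightarrow> (\<forall>x\<in>?X. \<chi> x z = \<chi> x z')))"
    using product_colouring[where 'z = "nat list", OF finite_words[of N T], of r] by blast
  \<comment> \<open>There are \<open>H + 1\<close> words \<open>B p\<close> with
    \<open>p \<le> H\<close> but only \<open>R2 + 1\<close> colours, so two of them collide.\<close>
  define H where "H = Suc R2"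
  show ?case
  proof (intro exI[of _ "N + H"] allI impI)
    fix \<chi> :: "nat list \<Rightarrow> nat" assume \<chi>: "\<forall>x. \<chi> x \<le> r"
    from R2[rule_format, of "\<lambda>x z. \<chi> (x @ z)", OF \<chi>[rule_format]] obtain \<psi> where \<psi>: "\<And>z. \<psi> z \<le> R2"
      "\<And>z z' x. \<psi> z = \<psi> z' \<Longrightarrow> x \<in> ?X \<Longrightarrow> \<chi> (x @ z) = \<chi> (x @ z')" by blast
    define B where "B p = replicate p 0 @ replicate (H - p) b" for p
    have "\<not> inj_on (\<lambda>p. \<psi> (B p)) {..H}"
    proof
      assume "inj_on (\<lambda>p. \<psi> (B p)) {..H}"
      then have "card {..H} \<le> card {..R2}"
        by (rule card_inj_on_le) (use \<psi>(1) in auto)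
      then show False by (simp add: H_def)
    qed
    then obtain p q where pq: "p < q" "q \<le> H" "\<psi> (B p) = \<psi> (B q)"
      unfolding inj_on_def by (metis atMost_iff linorder_neqE_nat)
    \<comment> \<open>\<open>l (T + n)\<close> becomes the last block, with the new parameter
      between the positions \<open>p\<close> and \<open>q\<close>; filling it with \<open>0\<close>
      or with \<open>b\<close> gives the two colliding words.\<close>
    define l where "l c = replicate p 0 @ replicate (q - p) c @ replicate (H - q) b" for c :: nat
    have l0: "l 0 = B q" and lb: "l b = B p"
      using pq by (simp_all add: l_def B_def replicate_add[symmetric] flip: append_assoc)
    from R1[rule_format, of "\<lambda>c x. \<chi> (x @ l c)", OF \<chi>[rule_format]] obtain \<psi>' where \<psi>': "\<forall>z. \<psi>' z \<le> R1"
      "\<And>z z' c. \<psi>' z = \<psi>' z' \<Longrightarrow> c < T \<Longrightarrow> \<chi> (z @ l c) = \<chi> (z' @ l c)" by (metis lessThan_iff)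
    from N[rule_format, of \<psi>'] \<psi>'(1) obtain w where w: "length w = N" "param_word T w (T + n)"
      "\<And>u u'. length u = n \<Longrightarrow> length u' = n \<Longrightarrow> set u \<subseteq> {..<T} \<Longrightarrow> set u' \<subseteq> {..<T} \<Longrightarrow>
         map ?f u = map ?f u' \<Longrightarrow> \<psi>' (subst T u w) = \<psi>' (subst T u' w)" by blast
    have rep: "param_word a (replicate k c) a" if "c < a" for a k c
      using that by (auto simp: param_word_const)
    have pl: "param_word (T + n) (l (T + n)) (T + Suc n)"
    proof -
      obtain k where k: "q - p = Suc k" using pq by (cases "q - p") auto
      have "param_word (T + n) (replicate (q - p) (T + n)) (Suc (T + n))"
        unfolding k using rep[of "T + n" "Suc (T + n)" k] by simp
      then show ?thesis unfolding l_def param_word_append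
        using rep[of 0 "T + n" p] rep[of b "Suc (T + n)" "H - q"] b by auto
    qed
    have sub: "subst T (u @ [c]) (w @ l (T + n)) = subst T u w @ l c" if "length u = n" for u c
    proof -
      have "subst T (u @ [c]) w = subst T u w" using subst_append_left[of T w u] w(2) that by simp
      moreover have "subst T (u @ [c]) (l (T + n)) = l c"
        using b that by (simp add: subst_def l_def nth_append)
      ultimately show ?thesis by simp
    qed
    have "\<chi> (subst T u (w @ l (T + n))) = \<chi> (subst T u' (w @ l (T + n)))"
      if u: "length u = Suc n" "length u' = Suc n" "set u \<subseteq> {..<T}" "set u' \<subseteq> {..<T}"
        "map ?f u = map ?f u'" for u u'
    proof -
      obtain v c v' c' where v: "u = v @ [c]" "u' = v' @ [c']"
        using u(1,2) by (metis length_Suc_conv_rev)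
      have len: "length v = n" "length v' = n" using u v by auto
      have "\<chi> (subst T v w @ l c) = \<chi> (subst T v' w @ l c)"
        using w(3)[of v v'] u v len by (intro \<psi>'(2)) auto
      \<comment> \<open>The letters \<open>c\<close> and \<open>c'\<close> are equal or both lie in
        \<open>{0, b}\<close>.\<close>
      also have "\<dots> = \<chi> (subst T v' w @ l c')"
      proof -
        have "subst T v' w \<in> ?X"
          using param_word_subst[of T w v' T] w len u(4) v by (auto simp: param_word_const)
        then have "\<chi> (subst T v' w @ l b) = \<chi> (subst T v' w @ l 0)"
          unfolding l0 lb using \<psi>(2)[OF pq(3)] by blast
        moreover have "?f c = ?f c'" using u(5) v by simp
        ultimately show ?thesis by (auto split: if_splits)
      qed
      finally show ?thesis using sub[OF len(1), of c] sub[OF len(2), of c'] v by metis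
    qed
    moreover have "length (w @ l (T + n)) = N + H" using w pq by (simp add: l_def)
    moreover have "param_word T (w @ l (T + n)) (T + Suc n)"
      using w(2) pl param_word_append by blast
    ultimately show "\<exists>w. length w = N + H \<and> param_word T w (T + Suc n) \<and>
      (\<forall>u u'. length u = Suc n \<and> length u' = Suc n \<and> set u \<subseteq> {..<T} \<and> set u' \<subseteq> {..<T} \<and>
         map ?f u = map ?f u' \<longrightarrow> \<chi> (subst T u w) = \<chi> (subst T u' w))" by blast
  qed
qed

text \<open>For \<open>d = 0\<close> only constants are substituted, and this is the
  multidimensional Hales-Jewett property. The bound \<open>\<chi> x \<le> r\<close> allows
  \<open>r + 1\<close> colours.\<close>

definition gr_length :: "nat \<Rightarrow> nat \<Rightarrow> nat \<Rightarrow> nat \<Rightarrow> nat \<Rightarrow> bool" where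
  "gr_length t d m r N \<longleftrightarrow> (\<forall>\<chi> :: nat list \<Rightarrow> nat. (\<forall>x. \<chi> x \<le> r) \<longrightarrow>
    (\<exists>w c. length w = N \<and> param_word t w (t + m) \<and>
      (\<forall>u. length u = m \<and> param_word t u (t + d) \<longrightarrow> \<chi> (subst t u w) = c)))"

lemma gr_lengthE:
  fixes \<chi> :: "nat list \<Rightarrow> nat"
  assumes "gr_length t d m r N" "\<And>x. \<chi> x \<le> r"
  obtains w c where "length w = N" "param_word t w (t + m)"
    "\<And>u. length u = m \<Longrightarrow> param_word t u (t + d) \<Longrightarrow> \<chi> (subst t u w) = c"
  using assms unfolding gr_length_def by blast

text \<open>Once exchanging \<open>0\<close> and the new letter \<open>t\<close> does not affect the
  colour, the colouring is determined by words over the old alphabet.\<close>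

theorem hales_jewett: "t \<ge> 1 \<Longrightarrow> \<exists>N. gr_length t 0 m r N"
proof (induction t rule: nat_induct_at_least)
  case base
  show ?case unfolding gr_length_def
  proof (intro allI exI impI conjI)
    fix \<chi> :: "nat list \<Rightarrow> nat"  and u :: "nat list"
    show "length [1..<1 + m] = m" by simp
    show "param_word 1 [1..<1 + m] (1 + m)" by (rule param_word_upt) simp
    assume u: "length u = m \<and> param_word 1 u (1 + 0)"
    then have "u = replicate m 0"
      using param_word_set[of 1 u 1] by (intro replicate_eqI) auto
    then show "\<chi> (subst 1 u [1..<1 + m]) = \<chi> (subst 1 (replicate m 0) [1..<1 + m])" by simp
  qed
next
  case (Suc t)
  obtain n where n: "gr_length t 0 m r n" using Suc.IH by blast
  let ?f = "\<lambda>c. if c = t then 0 else c"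
  obtain N where N: "\<forall>\<chi> :: nat list \<Rightarrow> nat. (\<forall>x. \<chi> x \<le> r) \<longrightarrow>
    (\<exists>w. length w = N \<and> param_word (Suc t) w (Suc t + n) \<and>
      (\<forall>u u'. length u = n \<and> length u' = n \<and> set u \<subseteq> {..<Suc t} \<and> set u' \<subseteq> {..<Suc t} \<and>
         map ?f u = map ?f u' \<longrightarrow> \<chi> (subst (Suc t) u w) = \<chi> (subst (Suc t) u' w)))"
    using shelah_insensitivity[of t "Suc t" r n] by blast
  have "gr_length (Suc t) 0 m r N" unfolding gr_length_def
  proof (intro allI impI)
    fix \<chi> :: "nat list \<Rightarrow> nat" assume \<chi>: "\<forall>x. \<chi> x \<le> r"
    from N[rule_format, of \<chi>] \<chi> obtain w where w: "length w = N" "param_word (Suc t) w (Suc t + n)"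
      "\<And>u u'. length u = n \<Longrightarrow> length u' = n \<Longrightarrow> set u \<subseteq> {..<Suc t} \<Longrightarrow> set u' \<subseteq> {..<Suc t} \<Longrightarrow>
         map ?f u = map ?f u' \<Longrightarrow> \<chi> (subst (Suc t) u w) = \<chi> (subst (Suc t) u' w)" by blast
    obtain v c where v: "length v = n" "param_word t v (t + m)"
      "\<And>u. length u = m \<Longrightarrow> param_word t u (t + 0) \<Longrightarrow> \<chi> (subst (Suc t) (subst t u v) w) = c"
      by (rule gr_lengthE[OF n, of "\<lambda>x. \<chi> (subst (Suc t) x w)"]) (use \<chi> in auto)
    \<comment> \<open>Over the larger alphabet \<open>t\<close> is a constant, so the parameters of
      \<open>v\<close> move up by one.\<close>
    define v' where "v' = map (\<lambda>c. if c < t then c else c + 1) v"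
    have v': "length v' = n" "param_word (Suc t) v' (Suc t + m)"
      using v param_word_shift[OF v(2), of t 1] by (simp_all add: v'_def)
    have "\<chi> (subst (Suc t) u (subst (Suc t) v' w)) = c"
      if u: "length u = m" "param_word (Suc t) u (Suc t)" for u
    proof -
      have su: "set u \<subseteq> {..<Suc t}" using u(2) param_word_const by blast
      have fu: "set (map ?f u) \<subseteq> {..<t}" using su Suc.hyps by (auto simp: less_Suc_eq)
      have pf: "param_word t (map ?f u) t" using fu param_word_const by blast
      have eq: "map ?f (subst (Suc t) u v') = subst t (map ?f u) v"
      proof -
        have "c - t < length u" if "c \<in> set v" "\<not> c < t" for c
          using that param_word_set[OF v(2)] u(1) by (auto simp: less_diff_conv2 add.commute)
        then show ?thesis by (auto simp: subst_def v'_def)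
      qed
      have s1: "set (subst (Suc t) u v') \<subseteq> {..<Suc t}"
        using param_word_subst[of "Suc t" v' u "Suc t"] u v' param_word_const by auto
      have s2: "set (subst t (map ?f u) v) \<subseteq> {..<t}"
        using param_word_subst[of t v "map ?f u" t] u v pf param_word_const by auto
      have "subst (Suc t) u (subst (Suc t) v' w) = subst (Suc t) (subst (Suc t) u v') w"
        using w(2) v'(1) by (intro subst_subst) auto
      also have "\<chi> \<dots> = \<chi> (subst (Suc t) (subst t (map ?f u) v) w)"
      proof (rule w(3))
        have "map ?f (subst t (map ?f u) v) = subst t (map ?f u) v"
          using s2 by (intro map_idI) auto
        then show "map ?f (subst (Suc t) u v') = map ?f (subst t (map ?f u) v)" using eq by simp
      qed (use s1 s2 v v' in auto)
      also have "\<dots> = c" using v(3)[of "map ?f u"] u(1) pf by simp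
      finally show ?thesis .
    qed
    moreover have "param_word (Suc t) (subst (Suc t) v' w) (Suc t + m)"
      using w(2) v' by (intro param_word_subst) auto
    ultimately show "\<exists>w c. length w = N \<and> param_word (Suc t) w (Suc t + m) \<and>
      (\<forall>u. length u = m \<and> param_word (Suc t) u (Suc t + 0) \<longrightarrow> \<chi> (subst (Suc t) u w) = c)"
      using w(1) by (intro exI[of _ "subst (Suc t) v' w"] exI[of _ c]) auto
  qed
  then show ?case by blast
qed

section \<open>The Graham-Rothschild theorem by induction on the number of parameters\<close>

lemma param_word_const_append:
  "set x \<subseteq> {..<t} \<Longrightarrow> param_word t (x @ t # y) k \<longleftrightarrow> param_word (Suc t) y k"
  by (induction x) auto

text \<open>
  Once the first parameter has occurred it may be treated as a further constant, so the word
  behind it has one parameter less over a larger alphabet.  The positions at which the first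
  parameter can occur are treated one after the other, \<open>p\<close> being the number of those done.
\<close>

lemma prefix_determines_colour:
  assumes gr: "\<And>m r. \<exists>N. gr_length (Suc t) d m r N"
  shows "\<exists>N. \<forall>\<chi> :: nat list \<Rightarrow> nat. (\<forall>x. \<chi> x \<le> r) \<longrightarrow>
    (\<exists>w. length w = N \<and> param_word (t + p) w (t + p + s) \<and>
      (\<forall>x y y'. p \<le> length x \<and> length x + Suc (length y) = p + s \<and> length y' = length y \<and>
         set x \<subseteq> {..<t} \<and> param_word (Suc t) y (Suc t + d) \<and> param_word (Suc t) y' (Suc t + d) \<longrightarrow>
         \<chi> (subst t (x @ t # y) ([t..<t + p] @ w)) = \<chi> (subst t (x @ t # y') ([t..<t + p] @ w))))"
proof (induction s arbitrary: p)
  case 0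
  show ?case by (rule exI[of _ 0]) simp
next
  case (Suc s)
  from Suc.IH[of "Suc p"] obtain N where N: "\<forall>\<chi> :: nat list \<Rightarrow> nat. (\<forall>x. \<chi> x \<le> r) \<longrightarrow>
    (\<exists>w. length w = N \<and> param_word (t + Suc p) w (t + Suc p + s) \<and>
      (\<forall>x y y'. Suc p \<le> length x \<and> length x + Suc (length y) = Suc p + s \<and> length y' = length y \<and>
         set x \<subseteq> {..<t} \<and> param_word (Suc t) y (Suc t + d) \<and> param_word (Suc t) y' (Suc t + d) \<longrightarrow>
         \<chi> (subst t (x @ t # y) ([t..<t + Suc p] @ w))
           = \<chi> (subst t (x @ t # y') ([t..<t + Suc p] @ w))))" by blast
  let ?X = "{x. length x = p \<and> set x \<subseteq> {..<t}}"
  obtain R :: nat where R: "\<forall>\<chi> :: nat list \<Rightarrow> nat list \<Rightarrow> nat. (\<forall>x z. \<chi> x z \<le> r) \<longrightarrow>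
    (\<exists>\<psi>. (\<forall>z. \<psi> z \<le> R) \<and> (\<forall>z z'. \<psi> z = \<psi> z' \<longrightarrow> (\<forall>x\<in>?X. \<chi> x z = \<chi> x z')))"
    using product_colouring[where 'z = "nat list", OF finite_words[of p t], of r] by blast
  obtain n where n: "gr_length (Suc t) d N R n" using gr by blast
  show ?case
  proof (intro exI[of _ "Suc n"] allI impI)
    fix \<chi> :: "nat list \<Rightarrow> nat" assume \<chi>: "\<forall>x. \<chi> x \<le> r"
    from R[rule_format, of "\<lambda>x z. \<chi> (x @ t # z)", OF \<chi>[rule_format]] obtain \<psi> where
      \<psi>: "\<And>z. \<psi> z \<le> R"
        "\<And>z z' x. \<psi> z = \<psi> z' \<Longrightarrow> x \<in> ?X \<Longrightarrow> \<chi> (x @ t # z) = \<chi> (x @ t # z')" by blast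
    obtain w1 c where w1: "length w1 = n" "param_word (Suc t) w1 (Suc t + N)"
      "\<And>u. length u = N \<Longrightarrow> param_word (Suc t) u (Suc t + d) \<Longrightarrow> \<psi> (subst (Suc t) u w1) = c"
      by (rule gr_lengthE[OF n, of \<psi>]) (use \<psi>(1) in auto)
    \<comment> \<open>The constant \<open>t\<close> of \<open>w1\<close> turns into the parameter
      \<open>t + p\<close>; the parameters before it are those of
      \<open>[t..<t + p]\<close>.\<close>
    define w1' where "w1' = (t + p) # map (\<lambda>c. if c < t then c else c + p) w1"
    have w1': "param_word (t + p) w1' (t + Suc p + N)"
      using param_word_shift[OF w1(2), of t p] by (simp add: w1'_def algebra_simps)
    have full: "param_word t ([t..<t + p] @ w1') (t + (Suc p + N))"
      unfolding param_word_append using param_word_upt[of t "t + p"] w1' by (auto simp: algebra_simps)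
    from N[rule_format, of "\<lambda>u. \<chi> (subst t u ([t..<t + p] @ w1'))", OF \<chi>[rule_format]]
    obtain w2 where w2: "length w2 = N" "param_word (t + Suc p) w2 (t + Suc p + s)"
      "\<And>x y y'. Suc p \<le> length x \<Longrightarrow> length x + Suc (length y) = Suc p + s \<Longrightarrow>
         length y' = length y \<Longrightarrow>
         set x \<subseteq> {..<t} \<Longrightarrow> param_word (Suc t) y (Suc t + d) \<Longrightarrow> param_word (Suc t) y' (Suc t + d) \<Longrightarrow>
         \<chi> (subst t (subst t (x @ t # y) ([t..<t + Suc p] @ w2)) ([t..<t + p] @ w1'))
           = \<chi> (subst t (subst t (x @ t # y') ([t..<t + Suc p] @ w2)) ([t..<t + p] @ w1'))" by blast
    define U where "U = [t..<t + Suc p] @ w2"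
    have lU: "length U = Suc p + N" by (simp add: U_def w2)
    have pU: "param_word t U (t + (Suc p + s))"
      unfolding U_def param_word_append using param_word_upt[of t "t + Suc p"] w2(2)
      by (metis add.assoc le_add1)
    define w where "w = subst t U w1'"
    have Uw: "subst t U ([t..<t + p] @ w1') = [t..<t + p] @ w"
    proof -
      have "subst t U [t..<t + p] = take p U" by (rule subst_upt) (simp add: lU)
      also have "\<dots> = [t..<t + p]" by (simp add: U_def)
      finally show ?thesis by (simp add: w_def)
    qed
    have "param_word t ([t..<t + p] @ w) (t + (Suc p + s))"
      unfolding Uw[symmetric] using full lU pU by (intro param_word_subst) auto
    then have pw: "param_word (t + p) w (t + p + Suc s)"
      unfolding param_word_append using param_word_fun[OF param_word_upt[of t "t + p"]]
      by (auto simp: algebra_simps)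
    have comp: "subst t u ([t..<t + p] @ w) = subst t (subst t u U) ([t..<t + p] @ w1')" for u
      unfolding Uw[symmetric] using full lU by (intro subst_subst) auto
    \<comment> \<open>If the first parameter occurs exactly at position \<open>p\<close>, then
      everything behind it is an instance of \<open>w1\<close>, and on these instances
      \<open>\<psi>\<close> is constant.\<close>
    have short: "\<exists>z. length z = N \<and> param_word (Suc t) z (Suc t + d) \<and>
        subst t (x @ t # y) ([t..<t + p] @ w) = x @ t # subst (Suc t) z w1"
      if x: "length x = p" "p + Suc (length y) = p + Suc s" "set x \<subseteq> {..<t}"
        "param_word (Suc t) y (Suc t + d)" for x y
    proof -
      define z where "z = subst t (x @ t # y) w2"
      have ux: "param_word t (x @ t # y) (t + Suc d)"
        unfolding param_word_append using x(3,4) by (intro exI[of _ t]) (auto simp: param_word_const)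
      have uU: "subst t (x @ t # y) U = x @ t # z"
      proof -
        have "subst t (x @ t # y) [t..<t + Suc p] = take (Suc p) (x @ t # y)"
          using x by (intro subst_upt) auto
        also have "\<dots> = x @ [t]" using x by simp
        finally show ?thesis by (simp add: U_def z_def)
      qed
      have "param_word t (x @ t # z) (t + Suc d)"
        unfolding uU[symmetric] using pU x ux by (intro param_word_subst) auto
      then have pz: "param_word (Suc t) z (Suc t + d)"
        using param_word_const_append[OF x(3)] by simp
      have lz: "length z = N" by (simp add: z_def w2)
      have "subst t (x @ t # z) ([t..<t + p] @ w1') = x @ t # subst (Suc t) z w1"
      proof -
        have "subst t (x @ t # z) [t..<t + p] = take p (x @ t # z)"
          using x by (intro subst_upt) auto
        moreover have "subst t (x @ t # z) (map (\<lambda>c. if c < t then c else c + p) w1)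
            = subst (Suc t) z w1"
        proof -
          have "(x @ t # z) ! (c + p - t) = (if c = t then t else z ! (c - Suc t))" if "t \<le> c" for c
          proof -
            obtain k where "c = t + k" using \<open>t \<le> c\<close> le_Suc_ex by blast
            then show ?thesis using x(1) by (cases k) (auto simp: nth_append)
          qed
          then show ?thesis using x(1) by (auto simp: subst_def less_Suc_eq nth_append)
        qed
        ultimately show ?thesis using x(1) by (simp add: w1'_def nth_append)
      qed
      then show ?thesis unfolding comp uU using pz lz by blast
    qed
    have "\<chi> (subst t (x @ t # y) ([t..<t + p] @ w)) = \<chi> (subst t (x @ t # y') ([t..<t + p] @ w))"
      if x: "p \<le> length x" "length x + Suc (length y) = p + Suc s" "length y' = length y"
        "set x \<subseteq> {..<t}" "param_word (Suc t) y (Suc t + d)" "param_word (Suc t) y' (Suc t + d)"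
      for x y y'
    proof (cases "length x = p")
      case True
      obtain z where z: "length z = N" "param_word (Suc t) z (Suc t + d)"
        "subst t (x @ t # y) ([t..<t + p] @ w) = x @ t # subst (Suc t) z w1"
        using short[of x y] x True by auto
      obtain z' where z': "length z' = N" "param_word (Suc t) z' (Suc t + d)"
        "subst t (x @ t # y') ([t..<t + p] @ w) = x @ t # subst (Suc t) z' w1"
        using short[of x y'] x True by auto
      show ?thesis unfolding z(3) z'(3) using w1(3) z z' x(4) True by (intro \<psi>(2)) auto
    next
      case False
      then show ?thesis unfolding comp U_def using x by (intro w2(3)) auto
    qed
    moreover have "length w = Suc n" by (simp add: w_def w1'_def w1)
    ultimately show "\<exists>w. length w = Suc n \<and> param_word (t + p) w (t + p + Suc s) \<and>
      (\<forall>x y y'. p \<le> length x \<and> length x + Suc (length y) = p + Suc s \<and> length y' = length y \<and>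
         set x \<subseteq> {..<t} \<and> param_word (Suc t) y (Suc t + d) \<and> param_word (Suc t) y' (Suc t + d) \<longrightarrow>
         \<chi> (subst t (x @ t # y) ([t..<t + p] @ w)) = \<chi> (subst t (x @ t # y') ([t..<t + p] @ w)))"
      using pw by blast
  qed
qed

text \<open>Before its parameter number \<open>length pre2\<close> appears, \<open>w1\<close> uses
  only earlier parameters, and these receive letters of \<open>pre2\<close>. Hence first occurrences
  compose.\<close>

lemma subst_first_occurrence:
  assumes w2: "w2 = pre2 @ (t + j) # post2" "param_word t pre2 (t + j)"
    and w1: "w1 = pre1 @ (t + length pre2) # post1" "param_word t pre1 (t + length pre2)"
  shows "subst t w2 w1 = subst t pre2 pre1 @ (t + j) # subst t w2 post1"
    and "param_word t (subst t pre2 pre1) (t + j)"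
proof -
  have "subst t w2 pre1 = subst t pre2 pre1"
    unfolding w2(1) by (rule subst_append_left[OF w1(2)])
  then show "subst t w2 w1 = subst t pre2 pre1 @ (t + j) # subst t w2 post1"
    using w1(1) w2(1) by simp
  show "param_word t (subst t pre2 pre1) (t + j)"
    by (rule param_word_subst[OF w1(2) w2(2)])
qed

text \<open>Hales-Jewett makes all complete words agree, the induction hypothesis treats the shorter
  prefixes by a second substitution, and the new parameter is appended as one last letter, so that
  its prefix is the complete word.\<close>

lemma hales_jewett_prefixes:
  assumes t: "t \<ge> 1"
  shows "\<exists>M. \<forall>\<chi> :: nat list \<Rightarrow> nat. (\<forall>x. \<chi> x \<le> r) \<longrightarrow>
    (\<exists>w. length w = M \<and> param_word t w (t + m) \<and>
      (\<forall>j<m. \<exists>pre post c. w = pre @ (t + j) # post \<and> param_word t pre (t + j) \<and>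
         (\<forall>x. length x = j \<and> set x \<subseteq> {..<t} \<longrightarrow> \<chi> (subst t x pre) = c)))"
proof (induction m)
  case 0
  show ?case by (rule exI[of _ 0]) simp
next
  case (Suc m)
  then obtain M where M: "\<forall>\<chi> :: nat list \<Rightarrow> nat. (\<forall>x. \<chi> x \<le> r) \<longrightarrow>
    (\<exists>w. length w = M \<and> param_word t w (t + m) \<and>
      (\<forall>j<m. \<exists>pre post c. w = pre @ (t + j) # post \<and> param_word t pre (t + j) \<and>
         (\<forall>x. length x = j \<and> set x \<subseteq> {..<t} \<longrightarrow> \<chi> (subst t x pre) = c)))" by blast
  obtain L where L: "gr_length t 0 M r L" using hales_jewett[OF t] by blast
  show ?case
  proof (intro exI[of _ "Suc L"] allI impI)
    fix \<chi> :: "nat list \<Rightarrow> nat" assume \<chi>: "\<forall>x. \<chi> x \<le> r"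
    obtain w1 c1 where w1: "length w1 = L" "param_word t w1 (t + M)"
      "\<And>u. length u = M \<Longrightarrow> param_word t u (t + 0) \<Longrightarrow> \<chi> (subst t u w1) = c1"
      by (rule gr_lengthE[OF L, of \<chi>]) (use \<chi> in auto)
    have "\<exists>pre post. w1 = pre @ (t + i) # post \<and> param_word t pre (t + i)" if "i < M" for i
      using param_word_first[OF w1(2), of "t + i"] that by auto
    then obtain pre1 post1 where pre1: "\<And>i. i < M \<Longrightarrow> w1 = pre1 i @ (t + i) # post1 i"
      "\<And>i. i < M \<Longrightarrow> param_word t (pre1 i) (t + i)" by metis
    \<comment> \<open>A word \<open>y\<close> fills exactly the parameters that precede the first
      occurrence of parameter number \<open>length y\<close> in \<open>w1\<close>; so
      \<open>y\<close> codes a prefix.\<close>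
    from M[rule_format, of "\<lambda>y. \<chi> (subst t y (pre1 (length y)))", OF \<chi>[rule_format]]
    obtain w2 where w2: "length w2 = M" "param_word t w2 (t + m)"
      "\<And>j. j < m \<Longrightarrow> \<exists>pre post c. w2 = pre @ (t + j) # post \<and> param_word t pre (t + j) \<and>
         (\<forall>x. length x = j \<and> set x \<subseteq> {..<t} \<longrightarrow>
            \<chi> (subst t (subst t x pre) (pre1 (length (subst t x pre)))) = c)" by blast
    define w where "w = subst t w2 w1 @ [t + m]"
    have p21: "param_word t (subst t w2 w1) (t + m)"
      using w1 w2 by (intro param_word_subst) auto
    then have pw: "param_word t w (t + Suc m)"
      unfolding w_def param_word_append by (intro exI[of _ "t + m"]) simp
    have "\<exists>pre post c. w = pre @ (t + j) # post \<and> param_word t pre (t + j) \<and>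
         (\<forall>x. length x = j \<and> set x \<subseteq> {..<t} \<longrightarrow> \<chi> (subst t x pre) = c)" if "j < Suc m" for j
    proof (cases "j = m")
      case True
      have "\<chi> (subst t x (subst t w2 w1)) = c1" if x: "length x = m" "set x \<subseteq> {..<t}" for x
      proof -
        have "subst t x (subst t w2 w1) = subst t (subst t x w2) w1"
          using w1 w2 by (intro subst_subst) auto
        moreover have "param_word t (subst t x w2) t"
          using w2 x by (intro param_word_subst) (auto simp: param_word_const)
        ultimately show ?thesis using w1(3)[of "subst t x w2"] w2(1) by simp
      qed
      then show ?thesis using True p21 unfolding w_def by blast
    next
      case False
      then have "j < m" using that by simp
      from w2(3)[OF this] obtain pre post c where
        pre: "w2 = pre @ (t + j) # post" "param_word t pre (t + j)"
        "\<And>x. length x = j \<Longrightarrow> set x \<subseteq> {..<t} \<Longrightarrow>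
            \<chi> (subst t (subst t x pre) (pre1 (length pre))) = c" by auto
      have i: "length pre < M" using pre(1) w2(1) by auto
      note f = subst_first_occurrence[OF pre(1,2) pre1(1)[OF i] pre1(2)[OF i]]
      have "\<chi> (subst t x (subst t pre (pre1 (length pre)))) = c"
        if "length x = j" "set x \<subseteq> {..<t}" for x
        using pre(3)[OF that] subst_subst[OF pre1(2)[OF i]] by simp
      then show ?thesis using f unfolding w_def by (metis append.assoc append_Cons)
    qed
    moreover have "length w = Suc L" by (simp add: w_def w1)
    ultimately show "\<exists>w. length w = Suc L \<and> param_word t w (t + Suc m) \<and>
      (\<forall>j<Suc m. \<exists>pre post c. w = pre @ (t + j) # post \<and> param_word t pre (t + j) \<and>
         (\<forall>x. length x = j \<and> set x \<subseteq> {..<t} \<longrightarrow> \<chi> (subst t x pre) = c))"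
      using pw by blast
  qed
qed

lemma param_word_select:
  assumes t: "t \<ge> 1"
  shows "param_word t (map (\<lambda>i. if i \<in> J then t + card (J \<inter> {..<i}) else 0) [0..<n])
           (t + card (J \<inter> {..<n}))"
proof (induction n)
  case (Suc n)
  have "J \<inter> {..<Suc n} = (if n \<in> J then insert n (J \<inter> {..<n}) else J \<inter> {..<n})"
    by (auto simp: less_Suc_eq)
  then show ?case using Suc t by (auto simp: param_word_append intro!: exI[of _ "t + card (J \<inter> {..<n})"])
qed simp

text \<open>Pigeonhole: among \<open>Suc r * m\<close> parameters some \<open>m\<close> have
  prefixes of the same colour. The other parameters are filled with the constant
  \<open>0\<close>.\<close>

lemma hales_jewett_prefixes_mono:
  assumes t: "t \<ge> 1"
  shows "\<exists>M. \<forall>\<chi> :: nat list \<Rightarrow> nat. (\<forall>x. \<chi> x \<le> r) \<longrightarrow>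
    (\<exists>w c. length w = M \<and> param_word t w (t + m) \<and>
      (\<forall>j<m. \<exists>pre post. w = pre @ (t + j) # post \<and> param_word t pre (t + j) \<and>
         (\<forall>x. length x = j \<and> set x \<subseteq> {..<t} \<longrightarrow> \<chi> (subst t x pre) = c)))"
proof -
  define n where "n = Suc r * m"
  from hales_jewett_prefixes[OF t, of r n] obtain M where
    M: "\<forall>\<chi> :: nat list \<Rightarrow> nat. (\<forall>x. \<chi> x \<le> r) \<longrightarrow>
    (\<exists>w. length w = M \<and> param_word t w (t + n) \<and>
      (\<forall>j<n. \<exists>pre post c. w = pre @ (t + j) # post \<and> param_word t pre (t + j) \<and>
         (\<forall>x. length x = j \<and> set x \<subseteq> {..<t} \<longrightarrow> \<chi> (subst t x pre) = c)))" by blast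
  show ?thesis
  proof (intro exI[of _ M] allI impI)
    fix \<chi> :: "nat list \<Rightarrow> nat" assume \<chi>: "\<forall>x. \<chi> x \<le> r"
    from M[rule_format, of \<chi>, OF \<chi>[rule_format]] obtain w where w: "length w = M"
      "param_word t w (t + n)"
      "\<forall>j<n. \<exists>pre post c. w = pre @ (t + j) # post \<and> param_word t pre (t + j) \<and>
         (\<forall>x. length x = j \<and> set x \<subseteq> {..<t} \<longrightarrow> \<chi> (subst t x pre) = c)" by blast
    from w(3) obtain pre1 post1 col where pre1: "\<And>j. j < n \<Longrightarrow> w = pre1 j @ (t + j) # post1 j"
      "\<And>j. j < n \<Longrightarrow> param_word t (pre1 j) (t + j)"
      "\<And>j x. j < n \<Longrightarrow> length x = j \<Longrightarrow> set x \<subseteq> {..<t} \<Longrightarrow> \<chi> (subst t x (pre1 j)) = col j"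
      by metis
    have col: "col j \<le> r" if "j < n" for j
    proof -
      have "\<chi> (subst t (replicate j 0) (pre1 j)) = col j"
        using that t by (intro pre1(3)) auto
      then show ?thesis using \<chi> by metis
    qed
    have "\<exists>c. m \<le> card {j. j < n \<and> col j = c}"
    proof (rule ccontr)
      assume "\<nexists>c. m \<le> card {j. j < n \<and> col j = c}"
      then have small: "card {j. j < n \<and> col j = c} < m" for c by (meson not_le)
      have "{..<n} = (\<Union>c\<in>{..r}. {j. j < n \<and> col j = c})" using col by auto
      then have "n \<le> (\<Sum>c\<in>{..r}. card {j. j < n \<and> col j = c})"
        using card_UN_le[of "{..r}" "\<lambda>c. {j. j < n \<and> col j = c}"] by (metis card_lessThan finite_atMost)
      also have "\<dots> < (\<Sum>c\<in>{..r}. m)" using small by (intro sum_strict_mono) auto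
      finally show False by (simp add: n_def)
    qed
    then obtain c J where J: "J \<subseteq> {j. j < n \<and> col j = c}" "card J = m"
      by (metis obtain_subset_with_card_n)
    define v where "v = map (\<lambda>i. if i \<in> J then t + card (J \<inter> {..<i}) else 0) [0..<n]"
    have lv: "length v = n" by (simp add: v_def)
    have "J \<inter> {..<n} = J" using J by auto
    then have pv: "param_word t v (t + m)"
      using param_word_select[OF t, of J n] J unfolding v_def by simp
    have "\<exists>pre post. subst t v w = pre @ (t + j) # post \<and> param_word t pre (t + j) \<and>
         (\<forall>x. length x = j \<and> set x \<subseteq> {..<t} \<longrightarrow> \<chi> (subst t x pre) = c)" if "j < m" for j
    proof -
      obtain pre post where v: "v = pre @ (t + j) # post" "param_word t pre (t + j)"
        using param_word_first[OF pv, of "t + j"] \<open>j < m\<close> by auto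
      have i: "length pre < n" using v lv by auto
      have "v ! length pre = t + j" by (simp add: v(1))
      then have "length pre \<in> J" using i t by (auto simp: v_def split: if_splits)
      then have ci: "col (length pre) = c" using J by auto
      note f = subst_first_occurrence[OF v pre1(1)[OF i] pre1(2)[OF i]]
      have "\<chi> (subst t x (subst t pre (pre1 (length pre)))) = c"
        if x: "length x = j" "set x \<subseteq> {..<t}" for x
      proof -
        have "set (subst t x pre) \<subseteq> {..<t}"
          using param_word_subst[of t pre x t] v(2) x by (auto simp: param_word_const)
        then have "\<chi> (subst t (subst t x pre) (pre1 (length pre))) = c"
          using pre1(3)[OF i, of "subst t x pre"] ci by simp
        then show ?thesis using subst_subst[OF pre1(2)[OF i]] by simp
      qed
      then show ?thesis using f by blast
    qed
    moreover have "param_word t (subst t v w) (t + m)" "length (subst t v w) = M"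
      using w lv pv by (auto intro: param_word_subst)
    ultimately show "\<exists>w c. length w = M \<and> param_word t w (t + m) \<and>
      (\<forall>j<m. \<exists>pre post. w = pre @ (t + j) # post \<and> param_word t pre (t + j) \<and>
         (\<forall>x. length x = j \<and> set x \<subseteq> {..<t} \<longrightarrow> \<chi> (subst t x pre) = c))" by blast
  qed
qed

text \<open>A word with \<open>Suc d\<close> parameters is cut at the first of them. By the
  induction hypothesis, with \<open>t\<close> as a further constant, the colour can be made to
  depend only on the part in front; that part consists of constants, so the prefix form of
  Hales-Jewett applies.\<close>

theorem graham_rothschild: "t \<ge> 1 \<Longrightarrow> \<exists>N. gr_length t d m r N"
proof (induction d arbitrary: t m r)
  case 0
  then show ?case by (rule hales_jewett)
next
  case (Suc d)
  note t = Suc.prems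
  from hales_jewett_prefixes_mono[OF t, of r m] obtain M where
    M: "\<forall>\<chi> :: nat list \<Rightarrow> nat. (\<forall>x. \<chi> x \<le> r) \<longrightarrow>
    (\<exists>w c. length w = M \<and> param_word t w (t + m) \<and>
      (\<forall>j<m. \<exists>pre post. w = pre @ (t + j) # post \<and> param_word t pre (t + j) \<and>
         (\<forall>x. length x = j \<and> set x \<subseteq> {..<t} \<longrightarrow> \<chi> (subst t x pre) = c)))" by blast
  have "\<And>m r. \<exists>N. gr_length (Suc t) d m r N" by (rule Suc.IH) simp
  from prefix_determines_colour[OF this, of r 0 M] obtain N where
    N: "\<forall>\<chi> :: nat list \<Rightarrow> nat. (\<forall>x. \<chi> x \<le> r) \<longrightarrow>
    (\<exists>w. length w = N \<and> param_word t w (t + M) \<and>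
      (\<forall>x y y'. length x + Suc (length y) = M \<and> length y' = length y \<and>
         set x \<subseteq> {..<t} \<and> param_word (Suc t) y (Suc t + d) \<and> param_word (Suc t) y' (Suc t + d) \<longrightarrow>
         \<chi> (subst t (x @ t # y) w) = \<chi> (subst t (x @ t # y') w)))" by auto
  have "gr_length t (Suc d) m r N" unfolding gr_length_def
  proof (intro allI impI)
    fix \<chi> :: "nat list \<Rightarrow> nat" assume \<chi>: "\<forall>x. \<chi> x \<le> r"
    from N[rule_format, of \<chi>, OF \<chi>[rule_format]] obtain w0 where w0: "length w0 = N"
      "param_word t w0 (t + M)"
      "\<And>x y y'. length x + Suc (length y) = M \<Longrightarrow> length y' = length y \<Longrightarrow>
         set x \<subseteq> {..<t} \<Longrightarrow> param_word (Suc t) y (Suc t + d) \<Longrightarrow> param_word (Suc t) y' (Suc t + d) \<Longrightarrow>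
         \<chi> (subst t (x @ t # y) w0) = \<chi> (subst t (x @ t # y') w0)" by blast
    \<comment> \<open>The tail does not influence the colour, so an arbitrary admissible tail turns
      the colouring of words into a colouring of prefixes.\<close>
    define Y where "Y x = (SOME y. length x + Suc (length y) = M \<and> param_word (Suc t) y (Suc t + d))"
      for x :: "nat list"
    from M[rule_format, of "\<lambda>x. \<chi> (subst t (x @ t # Y x) w0)", OF \<chi>[rule_format]]
    obtain w1 c where w1: "length w1 = M" "param_word t w1 (t + m)"
      "\<And>j. j < m \<Longrightarrow> \<exists>pre post. w1 = pre @ (t + j) # post \<and> param_word t pre (t + j) \<and>
         (\<forall>x. length x = j \<and> set x \<subseteq> {..<t} \<longrightarrow>
            \<chi> (subst t (subst t x pre @ t # Y (subst t x pre)) w0) = c)" by blast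
    have "\<chi> (subst t u (subst t w1 w0)) = c"
      if u: "length u = m" "param_word t u (t + Suc d)" for u
    proof -
      obtain x y where x: "u = x @ t # y" "param_word t x t" "param_word (Suc t) y (t + Suc d)"
        using param_word_first[OF u(2), of t] by auto
      have "length x < m" using x(1) u(1) by auto
      from w1(3)[OF this] obtain pre post where pre: "w1 = pre @ (t + length x) # post"
        "param_word t pre (t + length x)"
        "\<chi> (subst t (subst t x pre @ t # Y (subst t x pre)) w0) = c"
        using x(2) by (auto simp: param_word_const)
      define x' where "x' = subst t x pre"
      define y' where "y' = subst t u post"
      have eq: "subst t u w1 = x' @ t # y'"
        using subst_first_occurrence(1)[of u x t 0 y w1 pre post] x pre
        by (simp add: x'_def y'_def)
      have px': "param_word t x' t" unfolding x'_def by (rule param_word_subst[OF pre(2) x(2)])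
      have "param_word t (x' @ t # y') (t + Suc d)"
        unfolding eq[symmetric] using w1 u by (intro param_word_subst) auto
      then have py': "param_word (Suc t) y' (Suc t + d)"
        using param_word_const_append[of x' t] px' by (simp add: param_word_const)
      have "length (x' @ t # y') = M" unfolding eq[symmetric] using w1 by simp
      then have ly': "length x' + Suc (length y') = M" by simp
      have Y: "length x' + Suc (length (Y x')) = M \<and> param_word (Suc t) (Y x') (Suc t + d)"
        unfolding Y_def by (rule someI[of _ y']) (use py' ly' in blast)
      have "subst t u (subst t w1 w0) = subst t (x' @ t # y') w0"
        using subst_subst[of t w0 w1 u] w0 w1 eq by simp
      also have "\<chi> \<dots> = \<chi> (subst t (x' @ t # Y x') w0)"
        using Y py' ly' px' by (intro w0(3)) (auto simp: param_word_const)
      also have "\<dots> = c" using pre(3) by (simp add: x'_def)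
      finally show ?thesis .
    qed
    moreover have "param_word t (subst t w1 w0) (t + m)"
      using w0 w1 by (intro param_word_subst) auto
    ultimately show "\<exists>w c. length w = N \<and> param_word t w (t + m) \<and>
      (\<forall>u. length u = m \<and> param_word t u (t + Suc d) \<longrightarrow> \<chi> (subst t u w) = c)"
      using w0(1) by (intro exI[of _ "subst t w1 w0"] exI[of _ c]) auto
  qed
  then show ?case by blast
qed

text \<open>A rigid surjection onto a nonempty set starts with \<open>0\<close>; what follows is a
  parameter word over the one-letter alphabet, with one parameter less than there are
  letters.\<close>

corollary dual_ramsey:
  assumes "k \<ge> 1" "m \<ge> 1"
  shows "\<exists>N. \<forall>\<chi> :: nat list \<Rightarrow> nat. (\<forall>x. \<chi> x \<le> r) \<longrightarrow>
    (\<exists>w c. length w = N \<and> param_word 0 w m \<and>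
      (\<forall>u. length u = m \<and> param_word 0 u k \<longrightarrow> \<chi> (map ((!) u) w) = c))"
proof -
  obtain N where N: "gr_length 1 (k - 1) (m - 1) r N" using graham_rothschild by blast
  show ?thesis
  proof (intro exI[of _ "Suc N"] allI impI)
    fix \<chi> :: "nat list \<Rightarrow> nat" assume \<chi>: "\<forall>x. \<chi> x \<le> r"
    obtain w c where w: "length w = N" "param_word 1 w (1 + (m - 1))"
      "\<And>u. length u = m - 1 \<Longrightarrow> param_word 1 u (1 + (k - 1)) \<Longrightarrow> \<chi> (0 # subst 1 u w) = c"
      by (rule gr_lengthE[OF N, of "\<lambda>x. \<chi> (0 # x)"]) (use \<chi> in auto)
    have "\<chi> (map ((!) u) (0 # w)) = c" if u: "length u = m" "param_word 0 u k" for u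
    proof -
      obtain v where v: "u = 0 # v" "param_word 1 v k" using u assms by (cases u) auto
      have "map ((!) u) (0 # w) = 0 # subst 1 v w" by (auto simp: subst_def v nth_Cons split: nat.splits)
      then show ?thesis using w(3)[of v] v u assms by simp
    qed
    then show "\<exists>w c. length w = Suc N \<and> param_word 0 w m \<and>
      (\<forall>u. length u = m \<and> param_word 0 u k \<longrightarrow> \<chi> (map ((!) u) w) = c)"
      using w assms by (intro exI[of _ "0 # w"] exI[of _ c]) auto
  qed
qed

section \<open>The diversity of words over subadditive functions\<close>

lemma diversityD:
  assumes "diversity A d"
  shows diversity_nonneg: "finite X \<Longrightarrow> X \<subseteq> A \<Longrightarrow> 0 \<le> d X"
    and diversity_eq_0: "finite X \<Longrightarrow> X \<subseteq> A \<Longrightarrow> d X = 0 \<longleftrightarrow> card X \<le> 1"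
    and diversity_triangle: "finite X \<Longrightarrow> X \<subseteq> A \<Longrightarrow> finite Y \<Longrightarrow> Y \<subseteq> A \<Longrightarrow> finite Z \<Longrightarrow> Z \<subseteq> A \<Longrightarrow>
      Y \<noteq> {} \<Longrightarrow> d (X \<union> Z) \<le> d (X \<union> Y) + d (Y \<union> Z)"
  using assms unfolding diversity_def by blast+

text \<open>Points are added one at a time; the triangle inequality through \<open>{z}\<close> costs
  only \<open>d {z} = 0\<close>.\<close>

lemma diversity_mono:
  assumes "diversity A d" "finite Y" "Y \<subseteq> A" "X \<subseteq> Y"
  shows "d X \<le> d Y"
proof -
  have "finite Z \<Longrightarrow> Z \<subseteq> Y \<Longrightarrow> d X \<le> d (X \<union> Z)" for Z
  proof (induction Z rule: finite_induct)
    case (insert z Z)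
    have fin: "finite (X \<union> Z)" using insert assms by (auto intro: finite_subset)
    have "d (X \<union> Z \<union> {}) \<le> d (X \<union> Z \<union> {z}) + d ({z} \<union> {})"
      by (rule diversity_triangle[OF assms(1)]) (use insert assms fin in auto)
    moreover have "d ({z} \<union> {}) = 0"
      using diversity_eq_0[OF assms(1), of "{z}"] insert assms by auto
    ultimately show ?case using insert by simp
  qed simp
  from this[OF assms(2) order.refl] show ?thesis using assms(4) by (simp add: Un_absorb1)
qed

text \<open>Each \<open>Z j\<close> is attached to \<open>Y\<close> at the point
  \<open>\<beta> j\<close>, by one triangle inequality through the singleton of that point.\<close>

lemma diversity_star:
  assumes "diversity A d" "finite Y" "Y \<subseteq> A" "finite J" "\<beta> ` J \<subseteq> Y"
    and "\<And>j. j \<in> J \<Longrightarrow> finite (Z j) \<and> Z j \<subseteq> A"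
  shows "d (Y \<union> (\<Union>j\<in>J. Z j)) \<le> d Y + (\<Sum>j\<in>J. d (insert (\<beta> j) (Z j)))"
  using assms(4-6)
proof (induction J rule: finite_induct)
  case (insert j J)
  let ?W = "Y \<union> (\<Union>j\<in>J. Z j)"
  have b: "\<beta> j \<in> Y" using insert by auto
  have "d (?W \<union> Z j) \<le> d (?W \<union> {\<beta> j}) + d ({\<beta> j} \<union> Z j)"
    by (rule diversity_triangle[OF assms(1)]) (use insert assms in auto)
  moreover have "?W \<union> {\<beta> j} = ?W" using b by auto
  moreover have "d ?W \<le> d Y + (\<Sum>j\<in>J. d (insert (\<beta> j) (Z j)))" using insert by auto
  moreover have "Y \<union> (\<Union>j\<in>insert j J. Z j) = ?W \<union> Z j" by auto
  ultimately show ?case using insert by simp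
qed simp

definition subadditive :: "'a set \<Rightarrow> ('a set \<Rightarrow> real) \<Rightarrow> bool" where
  "subadditive E f \<longleftrightarrow> f {} = 0 \<and> (\<forall>X\<subseteq>E. 0 \<le> f X) \<and> (\<forall>X Y. X \<subseteq> E \<and> Y \<subseteq> E \<longrightarrow> f (X \<union> Y) \<le> f X + f Y)"

lemma subadditive_UN:
  assumes "subadditive E f" "finite J" "\<And>j. j \<in> J \<Longrightarrow> G j \<subseteq> E"
  shows "f (\<Union>j\<in>J. G j) \<le> (\<Sum>j\<in>J. f (G j))"
  using assms(2,3)
proof (induction J rule: finite_induct)
  case empty
  then show ?case using assms(1) by (simp add: subadditive_def)
next
  case (insert j J)
  have "f (G j \<union> (\<Union>j\<in>J. G j)) \<le> f (G j) + f (\<Union>j\<in>J. G j)"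
    using assms(1) insert.prems unfolding subadditive_def by (metis UN_least insertCI)
  then show ?case using insert by fastforce
qed

text \<open>Requiring empty values outside \<open>X\<close> makes the set of families finite and
  places the support \<open>{x. F x \<noteq> {}}\<close> inside \<open>X\<close>.\<close>

definition Fam :: "'e set \<Rightarrow> 'x set \<Rightarrow> ('x \<Rightarrow> 'e set) set" where
  "Fam E X = {F. \<forall>x. F x \<subseteq> (if x \<in> X then E else {})}"

lemma FamD: "F \<in> Fam E X \<Longrightarrow> F x \<subseteq> E" "F \<in> Fam E X \<Longrightarrow> x \<notin> X \<Longrightarrow> F x = {}"
  unfolding Fam_def by (auto split: if_splits)

lemma FamI: "(\<And>x. x \<in> X \<Longrightarrow> F x \<subseteq> E) \<Longrightarrow> (\<And>x. x \<notin> X \<Longrightarrow> F x = {}) \<Longrightarrow> F \<in> Fam E X"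
  unfolding Fam_def by auto

lemma finite_Fam:
  assumes "finite E" "finite X"
  shows "finite (Fam E X)"
proof -
  have "Fam E X \<subseteq> {F. \<forall>x. (x \<in> X \<longrightarrow> F x \<in> Pow E) \<and> (x \<notin> X \<longrightarrow> F x = {})}"
    unfolding Fam_def by auto
  moreover have "finite \<dots>" using assms by (intro finite_set_of_finite_funs) auto
  ultimately show ?thesis by (rule finite_subset)
qed

text \<open>
  The subadditive set functions form an injective diversity, and \<open>gap\<close> is the supremum of
  its pullbacks along the coordinates \<open>i \<in> I\<close>.  For a one-point set \<open>E\<close> it is the diameter
  with respect to the supremum metric.
\<close>

definition gap :: "'e set \<Rightarrow> 'i set \<Rightarrow> ('i \<Rightarrow> 'x \<Rightarrow> 'e set \<Rightarrow> real) \<Rightarrow> 'x set \<Rightarrow> real" where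
  "gap E I \<phi> X = (if X = {} then 0 else
     Max ((\<lambda>(i, x, F). \<phi> i x (\<Union>y\<in>X. F y) - (\<Sum>y\<in>X. \<phi> i y (F y))) ` (I \<times> X \<times> Fam E X)))"

lemma gap_le_iff:
  assumes "finite E" "finite I" "I \<noteq> {}" "finite X" "X \<noteq> {}"
  shows "gap E I \<phi> X \<le> r \<longleftrightarrow>
    (\<forall>i\<in>I. \<forall>x\<in>X. \<forall>F\<in>Fam E X. \<phi> i x (\<Union>y\<in>X. F y) \<le> (\<Sum>y\<in>X. \<phi> i y (F y)) + r)"
proof -
  let ?S = "(\<lambda>(i, x, F). \<phi> i x (\<Union>y\<in>X. F y) - (\<Sum>y\<in>X. \<phi> i y (F y))) ` (I \<times> X \<times> Fam E X)"
  have fin: "finite ?S" using assms by (intro finite_imageI finite_cartesian_product finite_Fam)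
  have "(\<lambda>_. {}) \<in> Fam E X" by (simp add: Fam_def)
  then have ne: "?S \<noteq> {}" using assms by blast
  have "Max ?S \<le> r \<longleftrightarrow> (\<forall>s\<in>?S. s \<le> r)" by (rule Max_le_iff[OF fin ne])
  also have "\<dots> \<longleftrightarrow>
    (\<forall>i\<in>I. \<forall>x\<in>X. \<forall>F\<in>Fam E X. \<phi> i x (\<Union>y\<in>X. F y) \<le> (\<Sum>y\<in>X. \<phi> i y (F y)) + r)"
    by (auto simp: diff_le_eq add.commute)
  finally show ?thesis using assms by (simp add: gap_def)
qed

lemma le_gap:
  assumes "finite E" "finite I" "finite X" "i \<in> I" "x \<in> X" "F \<in> Fam E X"
  shows "\<phi> i x (\<Union>y\<in>X. F y) \<le> (\<Sum>y\<in>X. \<phi> i y (F y)) + gap E I \<phi> X"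
  using gap_le_iff[of E I X \<phi> "gap E I \<phi> X"] assms by blast

lemma diversity_gap:
  assumes fin: "finite E" "finite I" "I \<noteq> {}" "finite T"
    and sub: "\<And>i x. i \<in> I \<Longrightarrow> x \<in> T \<Longrightarrow> subadditive E (\<phi> i x)"
    and sep: "\<And>x y. x \<in> T \<Longrightarrow> y \<in> T \<Longrightarrow> x \<noteq> y \<Longrightarrow> \<exists>i\<in>I. \<exists>C\<subseteq>E. \<phi> i x C \<noteq> \<phi> i y C"
  shows "diversity T (gap E I \<phi>)"
proof -
  have emp: "\<phi> i x {} = 0" if "i \<in> I" "x \<in> T" for i x
    using sub[OF that] by (simp add: subadditive_def)
  \<comment> \<open>Families are empty outside \<open>X\<close>, so sums and unions over different
    subsets can all be taken over \<open>T\<close> and compared there.\<close>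
  have ext: "(\<Sum>y\<in>X. \<phi> i y (F y)) = (\<Sum>y\<in>T. \<phi> i y (F y))" "(\<Union>y\<in>X. F y) = (\<Union>y\<in>T. F y)"
    if "i \<in> I" "X \<subseteq> T" "F \<in> Fam E X" for i X F
  proof -
    show "(\<Sum>y\<in>X. \<phi> i y (F y)) = (\<Sum>y\<in>T. \<phi> i y (F y))"
      using that fin emp FamD(2)[OF that(3)] by (intro sum.mono_neutral_left) auto
    show "(\<Union>y\<in>X. F y) = (\<Union>y\<in>T. F y)"
      using that FamD(2)[OF that(3)] by blast
  qed
  have nonneg: "0 \<le> gap E I \<phi> X" if "X \<subseteq> T" for X
  proof (cases "X = {}")
    case False
    then obtain i x where ix: "i \<in> I" "x \<in> X" using fin by blast
    have "\<phi> i x (\<Union>y\<in>X. {}) \<le> (\<Sum>y\<in>X. \<phi> i y {}) + gap E I \<phi> X"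
      using that fin ix by (intro le_gap) (auto simp: Fam_def intro: finite_subset)
    moreover have "(\<Sum>y\<in>X. \<phi> i y {}) = 0" using emp ix that by (intro sum.neutral) auto
    ultimately show ?thesis using emp ix that by auto
  qed (simp add: gap_def)
  have le: "\<phi> i x (\<Union>y\<in>T. F y) \<le> (\<Sum>y\<in>T. \<phi> i y (F y)) + gap E I \<phi> X"
    if "i \<in> I" "X \<subseteq> T" "x \<in> X" "F \<in> Fam E X" for i x X F
    using le_gap[of E I X i x F \<phi>] ext[OF that(1,2,4)] fin that finite_subset by metis
  have zero: "gap E I \<phi> X = 0 \<longleftrightarrow> card X \<le> 1" if X: "X \<subseteq> T" for X
  proof
    have finX: "finite X" using X fin finite_subset by blast
    assume g: "gap E I \<phi> X = 0"
    show "card X \<le> 1"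
    proof (rule ccontr)
      assume "\<not> card X \<le> 1"
      then obtain x y where xy: "x \<in> X" "y \<in> X" "x \<noteq> y"
        using finX by (metis One_nat_def card_le_Suc0_iff_eq)
      obtain i C where i: "i \<in> I" "C \<subseteq> E" "\<phi> i x C \<noteq> \<phi> i y C" using sep xy X by blast
      have *: "\<phi> i x C \<le> \<phi> i y C" if "x \<in> X" "y \<in> X" for x y
      proof -
        let ?F = "\<lambda>z. if z = y then C else {}"
        have F: "?F \<in> Fam E X" using i that by (auto simp: Fam_def)
        have "(\<Union>z\<in>X. ?F z) = C" using that by auto
        moreover have "(\<Sum>z\<in>X. \<phi> i z (?F z)) = \<phi> i y C"
        proof -
          have "(\<Sum>z\<in>X. \<phi> i z (?F z)) = (\<Sum>z\<in>X. if z = y then \<phi> i y C else 0)"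
            using emp i X by (intro sum.cong) auto
          then show ?thesis using finX that by simp
        qed
        ultimately show ?thesis
          using le_gap[OF fin(1,2) finX i(1) that(1) F, of \<phi>] g by simp
      qed
      show False using *[OF xy(1,2)] *[OF xy(2,1)] i by simp
    qed
  next
    assume c: "card X \<le> 1"
    have finX: "finite X" using X fin finite_subset by blast
    show "gap E I \<phi> X = 0"
    proof (cases "X = {}")
      case False
      then obtain x where x: "X = {x}" using c finX by (metis card_0_eq card_1_singletonE le_Suc_eq le_zero_eq One_nat_def)
      have "gap E I \<phi> X \<le> 0" using gap_le_iff[OF fin(1-3) finX False, of \<phi> 0] x by simp
      then show ?thesis using nonneg[OF X] by simp
    qed (simp add: gap_def)
  qed
  have half: "\<phi> i x (\<Union>y\<in>T. F y) \<le> (\<Sum>y\<in>T. \<phi> i y (F y)) + (gap E I \<phi> (X \<union> Y) + gap E I \<phi> (Y \<union> Z))"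
    if XYZ: "X \<subseteq> T" "Y \<subseteq> T" "Z \<subseteq> T" "Y \<noteq> {}" and i: "i \<in> I" and x: "x \<in> X" and F: "F \<in> Fam E (X \<union> Z)"
    for i x F X Y Z
  proof -
    obtain g where g: "g \<in> Y" using XYZ by blast
    \<comment> \<open>The part of \<open>F\<close> outside \<open>X\<close> is collected in
      \<open>C\<close> and moved to the point \<open>g\<close> of \<open>Y\<close>. The gap of
      \<open>X \<union> Y\<close> bounds the resulting family, and the gap of
      \<open>Y \<union> Z\<close> pays for distributing \<open>C\<close> to its points
      again.\<close>
    define F1 where "F1 y = (if y \<in> X then F y else {})" for y
    define F2 where "F2 y = (if y \<in> X then {} else F y)" for y
    define C where "C = (\<Union>y\<in>T. F2 y)"
    define G where "G y = (if y = g then F1 y \<union> C else F1 y)" for y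
    have CE: "C \<subseteq> E" and F1E: "F1 y \<subseteq> E" for y
      using FamD(1)[OF F] by (auto simp: C_def F1_def F2_def split: if_splits)
    have G: "G \<in> Fam E (X \<union> Y)"
    proof (rule FamI)
      show "G y \<subseteq> E" for y using CE F1E[of y] by (auto simp: G_def)
      show "G y = {}" if "y \<notin> X \<union> Y" for y using that g by (auto simp: G_def F1_def)
    qed
    have F2: "F2 \<in> Fam E (Y \<union> Z)" using F by (auto simp: Fam_def F2_def split: if_splits)
    have "(\<Union>y\<in>T. F y) = (\<Union>y\<in>T. G y)"
      using g XYZ by (auto simp: G_def C_def F1_def F2_def split: if_splits)
    then have "\<phi> i x (\<Union>y\<in>T. F y) \<le> (\<Sum>y\<in>T. \<phi> i y (G y)) + gap E I \<phi> (X \<union> Y)"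
      using le[OF i _ _ G] x XYZ by simp
    also have "(\<Sum>y\<in>T. \<phi> i y (G y)) \<le> (\<Sum>y\<in>T. \<phi> i y (F1 y) + (if y = g then \<phi> i g C else 0))"
    proof (rule sum_mono)
      fix y assume "y \<in> T"
      then show "\<phi> i y (G y) \<le> \<phi> i y (F1 y) + (if y = g then \<phi> i g C else 0)"
        using sub[OF i, of y] CE F1E[of y] by (auto simp: G_def subadditive_def)
    qed
    also have "\<dots> = (\<Sum>y\<in>T. \<phi> i y (F1 y)) + \<phi> i g C"
      using g XYZ fin by (subst sum.distrib) auto
    also have "\<phi> i g C \<le> (\<Sum>y\<in>T. \<phi> i y (F2 y)) + gap E I \<phi> (Y \<union> Z)"
      unfolding C_def using le[OF i _ _ F2, of g] g XYZ by simp
    also have "(\<Sum>y\<in>T. \<phi> i y (F1 y)) + ((\<Sum>y\<in>T. \<phi> i y (F2 y)) + gap E I \<phi> (Y \<union> Z))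
        = (\<Sum>y\<in>T. \<phi> i y (F y)) + gap E I \<phi> (Y \<union> Z)"
    proof -
      have "(\<Sum>y\<in>T. \<phi> i y (F1 y)) + (\<Sum>y\<in>T. \<phi> i y (F2 y)) = (\<Sum>y\<in>T. \<phi> i y (F y))"
        unfolding sum.distrib[symmetric] using emp i by (intro sum.cong) (auto simp: F1_def F2_def)
      then show ?thesis by simp
    qed
    finally show ?thesis by simp
  qed
  have tri: "gap E I \<phi> (X \<union> Z) \<le> gap E I \<phi> (X \<union> Y) + gap E I \<phi> (Y \<union> Z)"
    if XYZ: "X \<subseteq> T" "Y \<subseteq> T" "Z \<subseteq> T" "Y \<noteq> {}" for X Y Z
  proof (cases "X \<union> Z = {}")
    case True
    then show ?thesis using nonneg[of "X \<union> Y"] nonneg[of "Y \<union> Z"] XYZ by (simp add: gap_def)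
  next
    case False
    have finXZ: "finite (X \<union> Z)" using XYZ fin finite_subset by blast
    show ?thesis
    proof (subst gap_le_iff[OF fin(1-3) finXZ False], intro ballI)
      fix i x F assume a: "i \<in> I" "x \<in> X \<union> Z" "F \<in> Fam E (X \<union> Z)"
      have "\<phi> i x (\<Union>y\<in>T. F y) \<le> (\<Sum>y\<in>T. \<phi> i y (F y)) + (gap E I \<phi> (X \<union> Y) + gap E I \<phi> (Y \<union> Z))"
      proof (cases "x \<in> X")
        case True
        then show ?thesis using half[OF XYZ a(1) _ a(3)] by simp
      next
        case False
        then show ?thesis using half[of Z Y X i x F] XYZ a by (simp add: Un_commute add.commute)
      qed
      then show "\<phi> i x (\<Union>y\<in>X \<union> Z. F y) \<le> (\<Sum>y\<in>X \<union> Z. \<phi> i y (F y)) + (gap E I \<phi> (X \<union> Y) + gap E I \<phi> (Y \<union> Z))"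
        using ext[OF a(1) _ a(3)] XYZ by simp
    qed
  qed
  show ?thesis unfolding diversity_def using nonneg zero tri by blast
qed

section \<open>Patterns and their extensions\<close>

definition lex_less :: "('k \<Rightarrow> 'o::linorder) \<Rightarrow> 'k set \<Rightarrow> ('k \<Rightarrow> 'v::linorder) \<Rightarrow> ('k \<Rightarrow> 'v) \<Rightarrow> bool" where
  "lex_less \<kappa> K h h' \<longleftrightarrow> (\<exists>k\<in>K. h k < h' k \<and> (\<forall>j\<in>K. \<kappa> j < \<kappa> k \<longrightarrow> h j = h' j))"

lemma lex_less_irrefl: "\<not> lex_less \<kappa> K h h"
  by (simp add: lex_less_def)

lemma lex_less_trans:
  assumes "inj_on \<kappa> K" "lex_less \<kappa> K f g" "lex_less \<kappa> K g h"
  shows "lex_less \<kappa> K f h"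
proof -
  obtain k where k: "k \<in> K" "f k < g k" "\<And>j. j \<in> K \<Longrightarrow> \<kappa> j < \<kappa> k \<Longrightarrow> f j = g j"
    using assms(2) unfolding lex_less_def by blast
  obtain l where l: "l \<in> K" "g l < h l" "\<And>j. j \<in> K \<Longrightarrow> \<kappa> j < \<kappa> l \<Longrightarrow> g j = h j"
    using assms(3) unfolding lex_less_def by blast
  consider "\<kappa> k < \<kappa> l" | "\<kappa> l < \<kappa> k" | "k = l"
    using assms(1) k(1) l(1) by (meson inj_onD linorder_neqE)
  then show ?thesis
  proof cases
    case 1
    then show ?thesis unfolding lex_less_def
      using k l by (intro bexI[of _ k]) (auto dest: less_trans)
  next
    case 2
    then show ?thesis unfolding lex_less_def
      using k l by (intro bexI[of _ l]) (auto dest: less_trans)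
  next
    case 3
    then show ?thesis unfolding lex_less_def
      using k l by (intro bexI[of _ k]) (auto dest: less_trans)
  qed
qed

lemma first_difference:
  assumes "finite K" "k \<in> K" "h k \<noteq> h' k"
  obtains l where "l \<in> K" "h l \<noteq> h' l" "\<kappa> l \<le> (\<kappa> k :: 'o::linorder)"
    "\<And>j. j \<in> K \<Longrightarrow> \<kappa> j < \<kappa> l \<Longrightarrow> h j = h' j"
proof -
  let ?D = "{j \<in> K. h j \<noteq> h' j}"
  have fin: "finite (\<kappa> ` ?D)" using assms by simp
  have "Min (\<kappa> ` ?D) \<in> \<kappa> ` ?D" using fin assms by (intro Min_in) auto
  then obtain l where l: "l \<in> ?D" "\<kappa> l = Min (\<kappa> ` ?D)" by auto
  show thesis
  proof (rule that[of l])
    show "\<kappa> l \<le> \<kappa> k" unfolding l(2) using fin assms by (intro Min_le) auto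
    show "h j = h' j" if "j \<in> K" "\<kappa> j < \<kappa> l" for j
      using that fin l(2) Min_le[OF fin, of "\<kappa> j"] by (metis (mono_tags, lifting) imageI leD mem_Collect_eq)
  qed (use l in auto)
qed

lemma lex_less_total:
  assumes "finite K" "k \<in> K" "h k \<noteq> h' k"
  shows "lex_less \<kappa> K h h' \<or> lex_less \<kappa> K h' h"
proof -
  obtain l where l: "l \<in> K" "h l \<noteq> h' l" "\<kappa> l \<le> \<kappa> k" "\<And>j. j \<in> K \<Longrightarrow> \<kappa> j < \<kappa> l \<Longrightarrow> h j = h' j"
    by (rule first_difference[where h = h and h' = h' and \<kappa> = \<kappa>, OF assms]) blast
  consider "h l < h' l" | "h' l < h l" using l(2) by (meson linorder_neqE)
  then show ?thesis
  proof cases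
    case 1
    then show ?thesis unfolding lex_less_def using l by (intro disjI1 bexI[of _ l]) auto
  next
    case 2
    then show ?thesis unfolding lex_less_def using l by (intro disjI2 bexI[of _ l]) auto
  qed
qed

text \<open>The first difference lies at \<open>k\<close> or before it, and up to there no entry of
  \<open>h\<close> exceeds that of \<open>h'\<close>.\<close>

lemma lex_lessI:
  assumes "finite K" "k \<in> K" "h k < h' k" "\<And>j. j \<in> K \<Longrightarrow> \<kappa> j < \<kappa> k \<Longrightarrow> h j \<le> h' j" "inj_on \<kappa> K"
  shows "lex_less \<kappa> K h h'"
proof -
  obtain l where l: "l \<in> K" "h l \<noteq> h' l" "\<kappa> l \<le> \<kappa> k" "\<And>j. j \<in> K \<Longrightarrow> \<kappa> j < \<kappa> l \<Longrightarrow> h j = h' j"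
    by (rule first_difference[where h = h and h' = h' and \<kappa> = \<kappa>, OF assms(1,2)]) (use assms in auto)
  have "h l < h' l"
  proof (cases "\<kappa> l < \<kappa> k")
    case True
    then show ?thesis using assms(4)[OF l(1)] l(2) by simp
  next
    case False
    then have "l = k" using l assms by (meson inj_onD order_le_imp_less_or_eq)
    then show ?thesis using assms by simp
  qed
  then show ?thesis unfolding lex_less_def using l by blast
qed

lemma ex_sorted_wrt_list:
  assumes "finite X" "\<And>x y z. x \<in> X \<Longrightarrow> y \<in> X \<Longrightarrow> z \<in> X \<Longrightarrow> R x y \<Longrightarrow> R y z \<Longrightarrow> R x z"
    and "\<And>x y. x \<in> X \<Longrightarrow> y \<in> X \<Longrightarrow> x \<noteq> y \<Longrightarrow> R x y \<or> R y x" and "\<And>x. \<not> R x x"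
  shows "\<exists>xs. set xs = X \<and> distinct xs \<and> sorted_wrt R xs"
  using assms(1-3)
proof (induction X rule: finite_induct)
  case (insert x X)
  have "\<exists>xs. set xs = X \<and> distinct xs \<and> sorted_wrt R xs"
    by (rule insert.IH) (use insert.prems in blast)+
  then obtain xs where xs: "set xs = X" "distinct xs" "sorted_wrt R xs" by blast
  let ?ys = "filter (\<lambda>y. R y x) xs @ x # filter (\<lambda>y. R x y) xs"
  have "set ?ys = insert x X" using xs insert.prems(2) insert.hyps by auto
  moreover have "distinct ?ys"
  proof -
    have "\<not> (R y x \<and> R x y)" if "y \<in> X" for y
      using insert.prems(1)[of y x y] assms(4) that by blast
    then show ?thesis using xs insert.hyps by auto
  qed
  moreover have "sorted_wrt R ?ys"
  proof -
    have "R y z" if "y \<in> X" "z \<in> X" "R y x" "R x z" for y z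
      using insert.prems(1)[of y x z] that by blast
    then show ?thesis using xs by (auto simp: sorted_wrt_append sorted_wrt_filter)
  qed
  ultimately show ?case by blast
qed simp

lemma param_word_set_eq: "param_word 0 w b \<Longrightarrow> set w = {..<b}"
  using param_word_set[of 0 w b] param_word_first[of 0 w b] by fastforce

lemma param_word_growth:
  assumes "param_word 0 w b" "i < length w" "c < w ! i"
  shows "\<exists>j<i. w ! j = c"
proof -
  have w: "w = take i w @ w ! i # drop (Suc i) w" using assms(2) by (rule id_take_nth_drop)
  obtain a where a: "param_word 0 (take i w) a" "param_word a (w ! i # drop (Suc i) w) b"
    using assms(1) w param_word_append by metis
  have "w ! i \<le> a" using a(2) by (auto split: if_splits)
  then have "c \<in> set (take i w)" using param_word_set_eq[OF a(1)] assms(3) by auto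
  then show ?thesis using assms(2) by (auto simp: in_set_conv_nth)
qed

text \<open>Converse of \<open>param_word_growth\<close>: rigidity says that each letter is preceded
  by all smaller ones. The restriction map is checked in this form.\<close>

lemma param_wordI:
  assumes "\<And>i c. i < length u \<Longrightarrow> c < u ! i \<Longrightarrow> \<exists>j<i. u ! j = c" "set u = {..<k}"
  shows "param_word 0 u k"
proof -
  have "\<exists>k. param_word 0 u k" using assms(1)
  proof (induction u rule: rev_induct)
    case (snoc x u)
    have "\<exists>j<i. u ! j = c" if "i < length u" "c < u ! i" for i c
      using snoc.prems[of i c] that by (auto simp: nth_append)
    then obtain k where k: "param_word 0 u k" using snoc.IH by blast
    have "x \<le> k"
    proof (rule ccontr)
      assume "\<not> x \<le> k"
      then have "\<exists>j<length u. u ! j = k" using snoc.prems[of "length u" k] by (auto simp: nth_append)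
      then have "k \<in> set u" by (auto simp: in_set_conv_nth)
      then show False using param_word_set_eq[OF k] by simp
    qed
    then have "\<exists>k'. param_word k [x] k'" by auto
    then show ?case using k param_word_append by blast
  qed auto
  then obtain k' where k': "param_word 0 u k'" by blast
  have "k = k'" using param_word_set_eq[OF k'] assms(2) by (metis lessThan_eq_iff)
  then show ?thesis using k' by simp
qed

section \<open>Patterns with truncated values and their largest extensions\<close>

text \<open>
  \<open>V\<close> is a finite set of admissible values closed under addition truncated at \<open>M\<close>, which
  keeps everything finite; \<open>M'\<close> is the largest value below \<open>M\<close>, and \<open>\<iota>\<close> only serves
  to order the subsets of \<open>E\<close>.
\<close>

locale scale =
  fixes E :: "'a set" and dE :: "'a set \<Rightarrow> real" and V :: "real set" and M M' :: real
    and \<iota> :: "'a set \<Rightarrow> nat"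
  assumes finE: "finite E" and div: "diversity E dE" and finV: "finite V"
    and V_bounds: "V \<subseteq> {0..M}" and zero_V: "0 \<in> V" and M_V: "M \<in> V" and M'_V: "M' \<in> V"
    and M'_less: "M' < M" and V_below: "v \<in> V \<Longrightarrow> v < M \<Longrightarrow> v \<le> M'" and M_le: "M \<le> 2 * M'"
    and V_add: "x \<in> V \<Longrightarrow> y \<in> V \<Longrightarrow> min M (x + y) \<in> V"
    and dE_V: "X \<subseteq> E \<Longrightarrow> dE X \<in> V" and dE_ge: "X \<subseteq> E \<Longrightarrow> card X \<ge> 2 \<Longrightarrow> M - M' \<le> dE X"
    and inj_\<iota>: "inj_on \<iota> (Pow E)"
begin

lemma V_nonneg: "v \<in> V \<Longrightarrow> 0 \<le> v" and V_le: "v \<in> V \<Longrightarrow> v \<le> M"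
  using V_bounds by auto

lemma V_sum:
  assumes "finite J" "\<And>j. j \<in> J \<Longrightarrow> f j \<in> V"
  shows "min M (\<Sum>j\<in>J. f j) \<in> V"
  using assms
proof (induction J rule: finite_induct)
  case empty
  then show ?case using zero_V V_le[OF zero_V] by (simp add: min_def)
next
  case (insert j J)
  have "min M (f j + min M (\<Sum>j\<in>J. f j)) \<in> V" using insert by (intro V_add) auto
  moreover have "min M (f j + min M (\<Sum>j\<in>J. f j)) = min M (\<Sum>j\<in>insert j J. f j)"
    using insert V_nonneg[of "f j"] by (auto simp: min_def)
  ultimately show ?case by simp
qed

definition isometry :: "'b set \<Rightarrow> ('b set \<Rightarrow> real) \<Rightarrow> ('b \<Rightarrow> 'a) \<Rightarrow> bool" where
  "isometry A d e \<longleftrightarrow> finite A \<and> inj_on e A \<and> e ` A \<subseteq> E \<and> (\<forall>X\<subseteq>A. d X = dE (e ` X))"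

definition Q :: "('a set \<Rightarrow> real) set" where
  "Q = {f \<in> Pow E \<rightarrow>\<^sub>E V. subadditive E f}"

text \<open>
  The patterns on \<open>A\<close> are the maps from \<open>A\<close> into \<open>Q\<close> that do not increase the
  diversity.
\<close>

definition Pat :: "'b set \<Rightarrow> ('b set \<Rightarrow> real) \<Rightarrow> ('b \<Rightarrow> 'a set \<Rightarrow> real) set" where
  "Pat A d = {p \<in> A \<rightarrow>\<^sub>E Q. \<forall>a\<in>A. \<forall>F\<in>Fam E A.
     p a (\<Union>y\<in>A. F y) \<le> (\<Sum>y\<in>A. p y (F y)) + d (insert a {y. F y \<noteq> {}})}"

lemma finite_Q: "finite Q"
  unfolding Q_def using finE finV by (intro finite_Collect_conjI disjI1) (simp add: finite_PiE)

lemma finite_Pat: "finite A \<Longrightarrow> finite (Pat A d)"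
  unfolding Pat_def using finite_Q by (intro finite_Collect_conjI disjI1) (simp add: finite_PiE)

lemma Q_V: "f \<in> Q \<Longrightarrow> C \<subseteq> E \<Longrightarrow> f C \<in> V"
  by (auto simp: Q_def PiE_def)

lemma Q_subadditive: "f \<in> Q \<Longrightarrow> subadditive E f"
  by (simp add: Q_def)

lemma Q_empty: "f \<in> Q \<Longrightarrow> f {} = 0"
  by (simp add: Q_def subadditive_def)

lemma Q_eqI:
  assumes "f \<in> Q" "g \<in> Q" "\<And>C. C \<subseteq> E \<Longrightarrow> f C = g C"
  shows "f = g"
  using assms unfolding Q_def by (intro PiE_ext[of f "Pow E" "\<lambda>_. V" g]) auto

lemma Pat_Q: "p \<in> Pat A d \<Longrightarrow> a \<in> A \<Longrightarrow> p a \<in> Q"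
  by (auto simp: Pat_def PiE_def)

lemma Pat_le: "p \<in> Pat A d \<Longrightarrow> a \<in> A \<Longrightarrow> F \<in> Fam E A \<Longrightarrow>
    p a (\<Union>y\<in>A. F y) \<le> (\<Sum>y\<in>A. p y (F y)) + d (insert a {y. F y \<noteq> {}})"
  by (auto simp: Pat_def)

lemma Pat_eqI:
  assumes "p \<in> Pat A d" "q \<in> Pat A d" "\<And>a C. a \<in> A \<Longrightarrow> C \<subseteq> E \<Longrightarrow> p a C = q a C"
  shows "p = q"
proof (rule PiE_ext[of p A "\<lambda>_. Q" q])
  show "p a = q a" if "a \<in> A" for a using assms that by (intro Q_eqI Pat_Q) auto
qed (use assms in \<open>auto simp: Pat_def\<close>)

lemma isometry_finite: "isometry A d e \<Longrightarrow> finite A"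
  by (simp add: isometry_def)

lemma supp_Fam: "F \<in> Fam E A \<Longrightarrow> {y. F y \<noteq> {}} \<subseteq> A"
  using FamD(2) by fastforce

lemma isometry_mono:
  assumes "isometry A d e" "Y \<subseteq> A" "X \<subseteq> Y"
  shows "d X \<le> d Y"
proof -
  have "dE (e ` X) \<le> dE (e ` Y)"
    using assms unfolding isometry_def
    by (intro diversity_mono[OF div]) (auto intro: finite_subset)
  then show ?thesis using assms unfolding isometry_def by auto
qed

lemma isometry_V: "isometry A d e \<Longrightarrow> X \<subseteq> A \<Longrightarrow> d X \<in> V"
  unfolding isometry_def using dE_V by (metis image_mono order_trans)

lemma isometry_ge:
  assumes "isometry A d e" "X \<subseteq> A" "x \<in> X" "y \<in> X" "x \<noteq> y"
  shows "M - M' \<le> d X"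
proof -
  have fin: "finite X" "inj_on e X" using assms unfolding isometry_def by (auto intro: finite_subset inj_on_subset)
  have "card X \<ge> 2" using card_mono[of X "{x, y}"] assms fin by simp
  then have "card (e ` X) \<ge> 2" using fin by (simp add: card_image)
  then show ?thesis using assms dE_ge[of "e ` X"] unfolding isometry_def by (metis image_mono order_trans)
qed

text \<open>
  The pointwise largest way to extend the pattern \<open>q\<close> along the isometry \<open>e\<close>.
\<close>

definition ext_val :: "'b set \<Rightarrow> ('b \<Rightarrow> 'a set \<Rightarrow> real) \<Rightarrow> ('b \<Rightarrow> 'a) \<Rightarrow> 'a \<Rightarrow> 'a set \<Rightarrow> real" where
  "ext_val A q e b C = Min (insert M ((\<lambda>F. (\<Sum>y\<in>A. q y (F y)) + dE (insert b (e ` {y. F y \<noteq> {}})))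
     ` {F \<in> Fam E A. (\<Union>y\<in>A. F y) = C}))"

definition extension :: "'b set \<Rightarrow> ('b \<Rightarrow> 'a set \<Rightarrow> real) \<Rightarrow> ('b \<Rightarrow> 'a) \<Rightarrow> 'a \<Rightarrow> 'a set \<Rightarrow> real" where
  "extension A q e = restrict (\<lambda>b. restrict (ext_val A q e b) (Pow E)) E"

context
  fixes A :: "'b set" and d and e :: "'b \<Rightarrow> 'a" and q
  assumes iso: "isometry A d e" and q: "q \<in> Pat A d"
begin

private lemma finA: "finite A" and eA: "e ` A \<subseteq> E" and injA: "inj_on e A"
  and dA: "X \<subseteq> A \<Longrightarrow> d X = dE (e ` X)"
  using iso by (auto simp: isometry_def)

private lemma fin_ext_val:
  "finite ((\<lambda>F. (\<Sum>y\<in>A. q y (F y)) + dE (insert b (e ` {y. F y \<noteq> {}})))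
     ` {F \<in> Fam E A. (\<Union>y\<in>A. F y) = C})"
  using finite_Fam[OF finE finA] by simp

lemma ext_val_le:
  assumes "F \<in> Fam E A"
  shows "ext_val A q e b (\<Union>y\<in>A. F y) \<le> (\<Sum>y\<in>A. q y (F y)) + dE (insert b (e ` {y. F y \<noteq> {}}))"
  unfolding ext_val_def using assms fin_ext_val by (intro Min_le) auto

lemma ext_val_le_M: "ext_val A q e b C \<le> M"
  unfolding ext_val_def using fin_ext_val by (intro Min_le) auto

lemma ext_val_cases:
  obtains "ext_val A q e b C = M"
  | F where "F \<in> Fam E A" "(\<Union>y\<in>A. F y) = C"
      "ext_val A q e b C = (\<Sum>y\<in>A. q y (F y)) + dE (insert b (e ` {y. F y \<noteq> {}}))"
proof -
  have "ext_val A q e b C \<in> insert M ((\<lambda>F. (\<Sum>y\<in>A. q y (F y)) + dE (insert b (e ` {y. F y \<noteq> {}})))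
     ` {F \<in> Fam E A. (\<Union>y\<in>A. F y) = C})"
    unfolding ext_val_def using fin_ext_val by (intro Min_in) auto
  then show thesis using that by auto
qed

private lemma q_V: "y \<in> A \<Longrightarrow> C \<subseteq> E \<Longrightarrow> q y C \<in> V"
  using Q_V[OF Pat_Q[OF q]] by blast

private lemma supp_E:
  assumes "F \<in> Fam E A"
  shows "e ` {y. F y \<noteq> {}} \<subseteq> E"
  using supp_Fam[OF assms] eA by blast

lemma ext_val_V:
  assumes "b \<in> E"
  shows "ext_val A q e b C \<in> V"
proof (rule ext_val_cases[of b C])
  assume "ext_val A q e b C = M"
  then show ?thesis using M_V by simp
next
  fix F assume F: "F \<in> Fam E A"
    and eq: "ext_val A q e b C = (\<Sum>y\<in>A. q y (F y)) + dE (insert b (e ` {y. F y \<noteq> {}}))"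
  let ?s = "\<Sum>y\<in>A. q y (F y)" and ?d = "dE (insert b (e ` {y. F y \<noteq> {}}))"
  have d: "?d \<in> V" using assms supp_E[OF F] by (intro dE_V) auto
  \<comment> \<open>\<open>V\<close> is closed under truncated sums only; as the value in question
    is at most \<open>M\<close>, truncation leaves it unchanged.\<close>
  have "min M ?s \<in> V" using finA q_V FamD(1)[OF F] by (intro V_sum) auto
  then have "min M (min M ?s + ?d) \<in> V" using d V_add by blast
  moreover have "min M (min M ?s + ?d) = ext_val A q e b C"
    using V_nonneg[OF d] ext_val_le_M[of b C] unfolding eq by (auto simp: min_def)
  ultimately show ?thesis by simp
qed

text \<open>One inequality for two purposes: with all \<open>\<beta> j = b\<close> it is
  subadditivity of \<open>ext_val A q e b\<close>, with \<open>\<beta>\<close> the identity it is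
  the pattern inequality on \<open>E\<close>. Optimal families for the summands are united, and
  \<open>diversity_star\<close> combines their diversity terms.\<close>

lemma ext_val_UN:
  assumes "b \<in> E" "finite J" "\<beta> ` J \<subseteq> E" "\<And>j. j \<in> J \<Longrightarrow> G j \<subseteq> E"
  shows "ext_val A q e b (\<Union>j\<in>J. G j) \<le> (\<Sum>j\<in>J. ext_val A q e (\<beta> j) (G j)) + dE (insert b (\<beta> ` J))"
proof (cases "\<exists>j\<in>J. ext_val A q e (\<beta> j) (G j) = M")
  case True
  \<comment> \<open>The left-hand side is capped at \<open>M\<close>, so a single summand equal to
    \<open>M\<close> already suffices.\<close>
  then obtain j where j: "j \<in> J" "ext_val A q e (\<beta> j) (G j) = M" by blast
  have "ext_val A q e (\<beta> j) (G j) \<le> (\<Sum>j\<in>J. ext_val A q e (\<beta> j) (G j))"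
    using j(1) assms ext_val_V V_nonneg by (intro member_le_sum) auto
  moreover have "0 \<le> dE (insert b (\<beta> ` J))" using assms by (intro V_nonneg dE_V) auto
  ultimately show ?thesis using j(2) ext_val_le_M[of b "\<Union>j\<in>J. G j"] by simp
next
  case False
  have "\<forall>j\<in>J. \<exists>F. F \<in> Fam E A \<and> (\<Union>y\<in>A. F y) = G j \<and>
      ext_val A q e (\<beta> j) (G j) = (\<Sum>y\<in>A. q y (F y)) + dE (insert (\<beta> j) (e ` {y. F y \<noteq> {}}))"
  proof
    fix j assume j: "j \<in> J"
    show "\<exists>F. F \<in> Fam E A \<and> (\<Union>y\<in>A. F y) = G j \<and>
      ext_val A q e (\<beta> j) (G j) = (\<Sum>y\<in>A. q y (F y)) + dE (insert (\<beta> j) (e ` {y. F y \<noteq> {}}))"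
      by (rule ext_val_cases[of "\<beta> j" "G j"]) (use False j in blast)+
  qed
  from bchoice[OF this] obtain F where F: "\<And>j. j \<in> J \<Longrightarrow> F j \<in> Fam E A" "\<And>j. j \<in> J \<Longrightarrow> (\<Union>y\<in>A. F j y) = G j"
    "\<And>j. j \<in> J \<Longrightarrow> ext_val A q e (\<beta> j) (G j)
       = (\<Sum>y\<in>A. q y (F j y)) + dE (insert (\<beta> j) (e ` {y. F j y \<noteq> {}}))" by blast
  define H where "H y = (\<Union>j\<in>J. F j y)" for y
  have H: "H \<in> Fam E A" using FamD[OF F(1)] unfolding H_def by (intro FamI) blast+
  have UH: "(\<Union>y\<in>A. H y) = (\<Union>j\<in>J. G j)" using F(2) unfolding H_def by blast
  have "(\<Sum>y\<in>A. q y (H y)) \<le> (\<Sum>y\<in>A. \<Sum>j\<in>J. q y (F j y))"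
    unfolding H_def using assms FamD(1)[OF F(1)] Q_subadditive[OF Pat_Q[OF q]]
    by (intro sum_mono subadditive_UN[of E]) auto
  also have "\<dots> = (\<Sum>j\<in>J. \<Sum>y\<in>A. q y (F j y))" by (rule sum.swap)
  finally have s: "(\<Sum>y\<in>A. q y (H y)) \<le> (\<Sum>j\<in>J. \<Sum>y\<in>A. q y (F j y))" .
  let ?Y = "insert b (\<beta> ` J)" and ?Z = "\<lambda>j. e ` {y. F j y \<noteq> {}}"
  have Z: "finite (?Z j)" "?Z j \<subseteq> E" if "j \<in> J" for j
    using supp_E[OF F(1)[OF that]] finE finite_subset by auto
  have "{y. H y \<noteq> {}} = (\<Union>j\<in>J. {y. F j y \<noteq> {}})" by (auto simp: H_def)
  then have HZ: "e ` {y. H y \<noteq> {}} = (\<Union>j\<in>J. ?Z j)" by (simp only: image_UN)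
  have YZ: "?Y \<union> (\<Union>j\<in>J. ?Z j) \<subseteq> E" using assms Z(2) by blast
  have "dE (insert b (e ` {y. H y \<noteq> {}})) \<le> dE (?Y \<union> (\<Union>j\<in>J. ?Z j))"
    unfolding HZ by (rule diversity_mono[OF div finite_subset[OF YZ finE] YZ]) blast
  also have "\<dots> \<le> dE ?Y + (\<Sum>j\<in>J. dE (insert (\<beta> j) (?Z j)))"
    using assms Z by (intro diversity_star[OF div]) auto
  finally have "ext_val A q e b (\<Union>j\<in>J. G j)
      \<le> (\<Sum>j\<in>J. \<Sum>y\<in>A. q y (F j y)) + (dE ?Y + (\<Sum>j\<in>J. dE (insert (\<beta> j) (?Z j))))"
    using ext_val_le[OF H, of b] s unfolding UH by linarith
  also have "\<dots> = (\<Sum>j\<in>J. ext_val A q e (\<beta> j) (G j)) + dE ?Y"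
    using F(3) by (simp add: sum.distrib)
  finally show ?thesis .
qed

lemma ext_val_empty:
  assumes "b \<in> E"
  shows "ext_val A q e b {} = 0"
proof -
  have "(\<lambda>_. {}) \<in> Fam E A" by (simp add: Fam_def)
  from ext_val_le[OF this, of b] have "ext_val A q e b {} \<le> (\<Sum>y\<in>A. q y {}) + dE {b}" by simp
  moreover have "(\<Sum>y\<in>A. q y {}) = 0" using Q_empty[OF Pat_Q[OF q]] by simp
  moreover have "dE {b} = 0" using diversity_eq_0[OF div, of "{b}"] assms by simp
  ultimately show ?thesis using V_nonneg[OF ext_val_V[OF assms]] by (simp add: order_antisym)
qed

text \<open>The family concentrated at \<open>a\<close> attains \<open>q a C\<close>; that no family
  does better is the pattern inequality of \<open>q\<close>.\<close>

lemma ext_val_image: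
  assumes a: "a \<in> A" and C: "C \<subseteq> E"
  shows "ext_val A q e (e a) C = q a C"
proof (rule antisym)
  let ?F = "\<lambda>y. if y = a then C else {}"
  have F: "?F \<in> Fam E A" using a C by (auto simp: Fam_def)
  have "(\<Sum>y\<in>A. q y (?F y)) = (\<Sum>y\<in>A. if y = a then q a C else 0)"
    using Q_empty[OF Pat_Q[OF q]] by (intro sum.cong) auto
  then have "(\<Sum>y\<in>A. q y (?F y)) = q a C" using a finA by simp
  moreover have "(\<Union>y\<in>A. ?F y) = C" using a by auto
  moreover have "dE (insert (e a) (e ` {y. ?F y \<noteq> {}})) = 0"
  proof -
    have eq: "insert (e a) (e ` {y. ?F y \<noteq> {}}) = {e a}" by auto
    have "dE {e a} = 0" using diversity_eq_0[OF div, of "{e a}"] a eA by auto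
    then show ?thesis by (simp only: eq)
  qed
  ultimately show "ext_val A q e (e a) C \<le> q a C" using ext_val_le[OF F, of "e a"] by simp
next
  show "q a C \<le> ext_val A q e (e a) C"
  proof (rule ext_val_cases[of "e a" C])
    assume "ext_val A q e (e a) C = M"
    then show ?thesis using V_le[OF q_V[OF a C]] by simp
  next
    fix F assume F: "F \<in> Fam E A" "(\<Union>y\<in>A. F y) = C"
      "ext_val A q e (e a) C = (\<Sum>y\<in>A. q y (F y)) + dE (insert (e a) (e ` {y. F y \<noteq> {}}))"
    have "d (insert a {y. F y \<noteq> {}}) = dE (insert (e a) (e ` {y. F y \<noteq> {}}))"
      using dA[of "insert a {y. F y \<noteq> {}}"] a supp_Fam[OF F(1)] by simp
    then show ?thesis using Pat_le[OF q a F(1)] F by simp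
  qed
qed

lemma extension_eq: "b \<in> E \<Longrightarrow> C \<subseteq> E \<Longrightarrow> extension A q e b C = ext_val A q e b C"
  by (simp add: extension_def)

lemma extension_Q:
  assumes b: "b \<in> E"
  shows "extension A q e b \<in> Q"
proof -
  have ad: "ext_val A q e b (X \<union> Y) \<le> ext_val A q e b X + ext_val A q e b Y" if "X \<subseteq> E" "Y \<subseteq> E" for X Y
  proof -
    have "ext_val A q e b (\<Union>j\<in>(UNIV::bool set). if j then X else Y)
        \<le> (\<Sum>j\<in>(UNIV::bool set). ext_val A q e b (if j then X else Y)) + dE (insert b ((\<lambda>_. b) ` (UNIV::bool set)))"
      using b that by (intro ext_val_UN) auto
    moreover have "dE {b} = 0" using diversity_eq_0[OF div, of "{b}"] b by simp
    ultimately show ?thesis by (simp add: UNIV_bool Un_commute add.commute)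
  qed
  then show ?thesis
    using b ext_val_V[OF b] ext_val_empty[OF b] V_nonneg
    by (auto simp: Q_def subadditive_def extension_def)
qed

lemma extension_Pat: "extension A q e \<in> Pat E dE"
proof -
  have "extension A q e \<in> E \<rightarrow>\<^sub>E Q" using extension_Q by (auto simp: extension_def)
  moreover have "extension A q e a (\<Union>y\<in>E. F y) \<le> (\<Sum>y\<in>E. extension A q e y (F y)) + dE (insert a {y. F y \<noteq> {}})"
    if a: "a \<in> E" and F: "F \<in> Fam E E" for a F
  proof -
    let ?J = "{y. F y \<noteq> {}}"
    have J: "?J \<subseteq> E" by (rule supp_Fam[OF F])
    have FE: "F y \<subseteq> E" for y using FamD(1)[OF F] .
    have "(\<Union>y\<in>E. F y) = (\<Union>y\<in>?J. F y)" using J by blast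
    then have "extension A q e a (\<Union>y\<in>E. F y) = ext_val A q e a (\<Union>y\<in>?J. F y)"
      using extension_eq[OF a, of "\<Union>y\<in>?J. F y"] FE by (metis UN_least)
    also have "\<dots> \<le> (\<Sum>y\<in>?J. ext_val A q e y (F y)) + dE (insert a ((\<lambda>y. y) ` ?J))"
      using a J FE finE finite_subset by (intro ext_val_UN) auto
    also have "(\<Sum>y\<in>?J. ext_val A q e y (F y)) = (\<Sum>y\<in>E. ext_val A q e y (F y))"
      using finE J ext_val_empty by (intro sum.mono_neutral_left) auto
    also have "\<dots> = (\<Sum>y\<in>E. extension A q e y (F y))"
      using extension_eq FE by (intro sum.cong) auto
    finally show ?thesis by simp
  qed
  ultimately show ?thesis by (auto simp: Pat_def)
qed

lemma compose_extension: "compose A (extension A q e) e = q"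
proof (rule PiE_ext[of _ A "\<lambda>_. Q"])
  show "compose A (extension A q e) e \<in> A \<rightarrow>\<^sub>E Q" using eA extension_Q by (auto simp: compose_def)
  show "q \<in> A \<rightarrow>\<^sub>E Q" using q by (simp add: Pat_def)
  fix a assume a: "a \<in> A"
  then have ea: "e a \<in> E" using eA by auto
  show "compose A (extension A q e) e a = q a"
    using a ea extension_eq[OF ea] ext_val_image[OF a] extension_Q[OF ea] Pat_Q[OF q a]
    by (intro Q_eqI) (auto simp: compose_def)
qed

end

text \<open>Allowing \<open>b\<close> outside the image of \<open>e\<close> bounds a pattern at new
  points by its values at old ones, just as \<open>ext_val\<close> does for the extension.\<close>

lemma Pat_le_image:
  assumes iso: "isometry A d e" and p: "p \<in> Pat E dE" and b: "b \<in> E" and F: "F \<in> Fam E A"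
  shows "p b (\<Union>y\<in>A. F y) \<le> (\<Sum>y\<in>A. p (e y) (F y)) + dE (insert b (e ` {y. F y \<noteq> {}}))"
proof -
  have eA: "e ` A \<subseteq> E" and injA: "inj_on e A" using iso by (auto simp: isometry_def)
  define G where "G c = (\<Union>y\<in>{y \<in> A. e y = c}. F y)" for c
  have G: "G \<in> Fam E E" using FamD[OF F] eA unfolding G_def by (intro FamI) blast+
  have Ge: "G (e y) = F y" if "y \<in> A" for y
  proof -
    have "{y' \<in> A. e y' = e y} = {y}" using injA that by (auto dest: inj_onD)
    then show ?thesis by (simp add: G_def)
  qed
  have "{c. G c \<noteq> {}} = e ` {y \<in> A. F y \<noteq> {}}" by (auto simp: G_def)
  also have "{y \<in> A. F y \<noteq> {}} = {y. F y \<noteq> {}}" using supp_Fam[OF F] by auto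
  finally have supp: "{c. G c \<noteq> {}} = e ` {y. F y \<noteq> {}}" .
  have "(\<Union>c\<in>E. G c) = (\<Union>y\<in>A. F y)" using eA by (auto simp: G_def)
  then have "p b (\<Union>y\<in>A. F y) \<le> (\<Sum>c\<in>E. p c (G c)) + dE (insert b (e ` {y. F y \<noteq> {}}))"
    using Pat_le[OF p b G] supp by simp
  also have "(\<Sum>c\<in>E. p c (G c)) = (\<Sum>c\<in>e ` A. p c (G c))"
  proof (rule sum.mono_neutral_right)
    show "\<forall>c\<in>E - e ` A. p c (G c) = 0"
    proof
      fix c assume c: "c \<in> E - e ` A"
      then have "G c = {}" by (auto simp: G_def)
      then show "p c (G c) = 0" using Q_empty[OF Pat_Q[OF p]] c by simp
    qed
  qed (use finE eA in auto)
  also have "\<dots> = (\<Sum>y\<in>A. p (e y) (F y))" using Ge by (simp add: sum.reindex[OF injA])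
  finally show ?thesis .
qed

lemma compose_Pat:
  assumes iso: "isometry A d e" and p: "p \<in> Pat E dE"
  shows "compose A p e \<in> Pat A d"
proof -
  have eA: "e ` A \<subseteq> E" and dA: "\<And>X. X \<subseteq> A \<Longrightarrow> d X = dE (e ` X)"
    using iso by (auto simp: isometry_def)
  have "compose A p e \<in> A \<rightarrow>\<^sub>E Q" using eA Pat_Q[OF p] by (auto simp: compose_def)
  moreover have "compose A p e a (\<Union>y\<in>A. F y)
      \<le> (\<Sum>y\<in>A. compose A p e y (F y)) + d (insert a {y. F y \<noteq> {}})"
    if a: "a \<in> A" and F: "F \<in> Fam E A" for a F
    using Pat_le_image[OF iso p _ F, of "e a"] dA[of "insert a {y. F y \<noteq> {}}"] a supp_Fam[OF F] eA
    by (auto simp: compose_def)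
  ultimately show ?thesis by (auto simp: Pat_def)
qed

section \<open>The order of patterns and the monotonicity of extension\<close>

text \<open>
  Comparing values level by level, from the smallest up, is what makes extension monotone:
  a value \<open>v < M\<close> of the extension at a new point is a sum of old values that are strictly
  smaller than \<open>v\<close>, because the diversity term in it is positive.
\<close>

definition pat_less :: "('b \<Rightarrow> nat) \<Rightarrow> 'b set \<Rightarrow> ('b \<Rightarrow> 'a set \<Rightarrow> real) \<Rightarrow> ('b \<Rightarrow> 'a set \<Rightarrow> real) \<Rightarrow> bool" where
  "pat_less \<rho> A p p' \<longleftrightarrow> lex_less (\<lambda>(v, a, C). (v, \<rho> a, \<iota> C)) (V \<times> A \<times> Pow E)
     (\<lambda>(v, a, C). p a C \<le> v) (\<lambda>(v, a, C). p' a C \<le> v)"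

lemma inj_key: "inj_on \<rho> A \<Longrightarrow> inj_on (\<lambda>(v, a, C). (v, \<rho> a, \<iota> C)) (V \<times> A \<times> Pow E)"
  using inj_\<iota> by (auto simp: inj_on_def)

lemma ex_sorted_Pat:
  assumes "finite A" "inj_on \<rho> A"
  shows "\<exists>ps. set ps = Pat A d \<and> distinct ps \<and> sorted_wrt (pat_less \<rho> A) ps"
proof (rule ex_sorted_wrt_list)
  show "finite (Pat A d)" using assms finite_Pat by blast
  show "pat_less \<rho> A x z" if "pat_less \<rho> A x y" "pat_less \<rho> A y z" for x y z
    using that unfolding pat_less_def by (rule lex_less_trans[OF inj_key[OF assms(2)]])
  show "\<not> pat_less \<rho> A x x" for x unfolding pat_less_def by (rule lex_less_irrefl)
  show "pat_less \<rho> A p p' \<or> pat_less \<rho> A p' p" if p: "p \<in> Pat A d" "p' \<in> Pat A d" "p \<noteq> p'" for p p'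
  proof -
    obtain a C where aC: "a \<in> A" "C \<subseteq> E" "p a C \<noteq> p' a C" using Pat_eqI p by blast
    define v where "v = min (p a C) (p' a C)"
    have "v \<in> V" using aC p Q_V[OF Pat_Q] by (auto simp: v_def min_def)
    moreover have "(p a C \<le> v) \<noteq> (p' a C \<le> v)" using aC(3) by (auto simp: v_def)
    ultimately show ?thesis unfolding pat_less_def
      using aC finE finV assms by (intro lex_less_total[where k = "(v, a, C)"]) auto
  qed
qed

text \<open>The key deciding \<open>q\<close> against the restriction of \<open>p\<close> also
  serves on \<open>E\<close>. At earlier keys equality may fail, but only in favour of the
  extension: every sublevel condition that it meets is met by \<open>p\<close>, which is enough for
  \<open>lex_lessI\<close>.\<close>

lemma pat_less_extension:
  assumes iso: "isometry A d e" and q: "q \<in> Pat A d" and p: "p \<in> Pat E dE"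
    and mono: "\<And>a a'. a \<in> A \<Longrightarrow> a' \<in> A \<Longrightarrow> \<sigma> (e a) < \<sigma> (e a') \<longleftrightarrow> \<rho> a < (\<rho> a' :: nat)"
    and inj: "inj_on \<rho> A" "inj_on \<sigma> E" and less: "pat_less \<rho> A q (compose A p e)"
  shows "pat_less \<sigma> E (extension A q e) p"
proof -
  note finA = isometry_finite[OF iso]
  have eA: "e ` A \<subseteq> E" and injA: "inj_on e A" using iso by (auto simp: isometry_def)
  let ?\<kappa> = "\<lambda>(v, a, C). (v, \<rho> a, \<iota> C)"
  let ?K = "V \<times> A \<times> Pow E" and ?h = "\<lambda>(v, a, C). q a C \<le> v"
    and ?h' = "\<lambda>(v, a, C). compose A p e a C \<le> v"
  obtain k where k': "k \<in> ?K" "?h k < ?h' k" "\<forall>j\<in>?K. ?\<kappa> j < ?\<kappa> k \<longrightarrow> ?h j = ?h' j"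
    using less unfolding pat_less_def lex_less_def by (elim bexE conjE) (rule that)
  then obtain v a C where kk: "k = (v, a, C)" and k: "v \<in> V" "a \<in> A" "C \<subseteq> E" "\<not> q a C \<le> v" "p (e a) C \<le> v"
    by (cases k) (auto simp: compose_def)
  have agree: "q a' C' \<le> v' \<longleftrightarrow> p (e a') C' \<le> v'"
    if "v' \<in> V" "a' \<in> A" "C' \<subseteq> E" "(v', \<rho> a', \<iota> C') < (v, \<rho> a, \<iota> C)" for v' a' C'
    using bspec[OF k'(3), of "(v', a', C')"] that kk by (auto simp: compose_def)
  have ea: "e a \<in> E" using k eA by auto
  have main: "p b C' \<le> v'"
    if v': "v' \<in> V" "b \<in> E" "C' \<subseteq> E" "(v', \<sigma> b, \<iota> C') < (v, \<sigma> (e a), \<iota> C)"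
      and x: "extension A q e b C' \<le> v'" for v' b C'
  proof (cases "b \<in> e ` A")
    case True
    then obtain a' where a': "a' \<in> A" "b = e a'" by blast
    have "(v', \<rho> a', \<iota> C') < (v, \<rho> a, \<iota> C)"
    proof -
      have "\<sigma> b = \<sigma> (e a) \<Longrightarrow> \<rho> a' = \<rho> a"
        using a' ea v'(2) inj(2) injA k(2) by (metis inj_onD)
      then show ?thesis using v'(4) mono[OF a'(1) k(2)] a'(2) by (auto simp: le_less)
    qed
    moreover have "q a' C' \<le> v'"
      using x extension_eq[OF iso q v'(2,3)] ext_val_image[OF iso q a'(1) v'(3)] a' by simp
    ultimately show ?thesis using agree[OF v'(1) a'(1) v'(3)] a' by simp
  next
    case False
    have le: "v' \<le> v" using v'(4) by auto
    show ?thesis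
    proof (rule ext_val_cases[OF iso q, of b C'])
      assume "ext_val A q e b C' = M"
      then have "M \<le> v'" using x extension_eq[OF iso q v'(2,3)] by simp
      then show ?thesis using V_le[OF Q_V[OF Pat_Q[OF p v'(2)] v'(3)]] by simp
    next
      fix F assume F: "F \<in> Fam E A" "(\<Union>y\<in>A. F y) = C'"
        "ext_val A q e b C' = (\<Sum>y\<in>A. q y (F y)) + dE (insert b (e ` {y. F y \<noteq> {}}))"
      have FE: "F y \<subseteq> E" for y using FamD(1)[OF F(1)] .
      have supp: "{y. F y \<noteq> {}} \<subseteq> A" by (rule supp_Fam[OF F(1)])
      have qF: "q y (F y) \<in> V" if "y \<in> A" for y using Q_V[OF Pat_Q[OF q that] FE] .
      have bound: "(\<Sum>y\<in>A. q y (F y)) + dE (insert b (e ` {y. F y \<noteq> {}})) \<le> v'"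
        using x extension_eq[OF iso q v'(2,3)] F(3) by simp
      have small: "p (e y) (F y) \<le> q y (F y)" if y: "y \<in> A" for y
      proof (cases "F y = {}")
        case True
        then show ?thesis using Q_empty[OF Pat_Q[OF q y]] Q_empty[OF Pat_Q[OF p, of "e y"]] y eA by auto
      next
        case ne: False
        have "q y (F y) \<le> (\<Sum>y\<in>A. q y (F y))"
          using y finA qF V_nonneg by (intro member_le_sum) auto
        moreover have "0 < dE (insert b (e ` {y. F y \<noteq> {}}))"
        proof -
          have sE: "insert b (e ` {y. F y \<noteq> {}}) \<subseteq> E" using supp eA v'(2) by blast
          have "card {b, e y} \<le> card (insert b (e ` {y. F y \<noteq> {}}))"
            using ne sE finE finite_subset by (intro card_mono) auto
          moreover have "b \<noteq> e y" using False y by auto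
          ultimately have "M - M' \<le> dE (insert b (e ` {y. F y \<noteq> {}}))" using sE by (intro dE_ge) auto
          then show ?thesis using M'_less by simp
        qed
        \<comment> \<open>Hence the key with level \<open>q y (F y)\<close> precedes the deciding
          one. At it \<open>q\<close> meets the sublevel condition trivially, so \<open>p\<close>
          meets it too.\<close>
        ultimately have "q y (F y) < v" using bound le by simp
        then show ?thesis using agree[OF qF[OF y] y FE, of y] by simp
      qed
      have "p b C' \<le> (\<Sum>y\<in>A. p (e y) (F y)) + dE (insert b (e ` {y. F y \<noteq> {}}))"
        using Pat_le_image[OF iso p v'(2) F(1)] F(2) by simp
      also have "(\<Sum>y\<in>A. p (e y) (F y)) \<le> (\<Sum>y\<in>A. q y (F y))" using small by (rule sum_mono)
      finally show ?thesis using bound by simp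
    qed
  qed
  show ?thesis unfolding pat_less_def
  proof (rule lex_lessI[where k = "(v, e a, C)"])
    show "finite (V \<times> E \<times> Pow E)" using finV finE by simp
    show "inj_on (\<lambda>(v, a, C). (v, \<sigma> a, \<iota> C)) (V \<times> E \<times> Pow E)" by (rule inj_key[OF inj(2)])
    show "(case (v, e a, C) of (v, a, C) \<Rightarrow> extension A q e a C \<le> v)
        < (case (v, e a, C) of (v, a, C) \<Rightarrow> p a C \<le> v)"
      using k extension_eq[OF iso q ea k(3)] ext_val_image[OF iso q k(2,3)] by simp
  qed (use main k ea in auto)
qed

end

section \<open>Coding points by words over \<open>Q\<close>\<close>

text \<open>Embeddings without the relational language; \<open>Emb_diversity\<close> identifies the
  two notions.\<close>

definition ordered_embeddings :: "'b set \<Rightarrow> ('b set \<Rightarrow> real) \<Rightarrow> ('b \<Rightarrow> 'b \<Rightarrow> bool) \<Rightarrow>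
    'c set \<Rightarrow> ('c set \<Rightarrow> real) \<Rightarrow> ('c \<Rightarrow> 'c \<Rightarrow> bool) \<Rightarrow> ('b \<Rightarrow> 'c) set" where
  "ordered_embeddings A d lt T D lt' = {f \<in> A \<rightarrow>\<^sub>E T. inj_on f A \<and> (\<forall>X\<subseteq>A. D (f ` X) = d X) \<and>
     (\<forall>a\<in>A. \<forall>a'\<in>A. lt' (f a) (f a') \<longleftrightarrow> lt a a')}"

context scale
begin

text \<open>The pointwise largest element of \<open>Q\<close>, which will be the first letter of the
  alphabet.\<close>

definition topf :: "'a set \<Rightarrow> real" where
  "topf = restrict (\<lambda>C. if C = {} then 0 else M) (Pow E)"

lemma two_valued_Q:
  assumes "m \<in> V" "M \<le> 2 * m"
  shows "restrict (\<lambda>C. if C = {} then 0 else m) (Pow E) \<in> Q"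
  using assms V_nonneg[OF assms(1)] zero_V by (auto simp: Q_def subadditive_def)

lemma topf_Q: "topf \<in> Q"
  unfolding topf_def using M_V V_nonneg[OF M_V] by (intro two_valued_Q) auto

definition canonical :: "'b set \<Rightarrow> ('b \<Rightarrow> 'a) \<Rightarrow> 'b \<Rightarrow> 'a set \<Rightarrow> real" where
  "canonical A e = restrict (\<lambda>a. restrict (\<lambda>C. dE (insert (e a) C)) (Pow E)) A"

lemma dE_singleton: "x \<in> E \<Longrightarrow> dE {x} = 0"
  using diversity_eq_0[OF div, of "{x}"] by simp

lemma canonical_Pat:
  assumes iso: "isometry A d e"
  shows "canonical A e \<in> Pat A d"
proof -
  have eA: "e ` A \<subseteq> E" and finA: "finite A" and dA: "\<And>X. X \<subseteq> A \<Longrightarrow> d X = dE (e ` X)"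
    using iso by (auto simp: isometry_def)
  have fin: "finite X" if "X \<subseteq> E" for X using that finE finite_subset by blast
  have "restrict (\<lambda>C. dE (insert x C)) (Pow E) \<in> Q" if x: "x \<in> E" for x
  proof -
    have "dE (insert x (X \<union> Y)) \<le> dE (insert x X) + dE (insert x Y)" if "X \<subseteq> E" "Y \<subseteq> E" for X Y
      using diversity_triangle[OF div, of "insert x X" "{x}" "insert x Y"] that x fin by auto
    then show ?thesis using x dE_V V_nonneg dE_singleton by (auto simp: Q_def subadditive_def)
  qed
  then have "canonical A e \<in> A \<rightarrow>\<^sub>E Q" using eA by (auto simp: canonical_def)
  moreover have "canonical A e a (\<Union>y\<in>A. F y)
      \<le> (\<Sum>y\<in>A. canonical A e y (F y)) + d (insert a {y. F y \<noteq> {}})"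
    if a: "a \<in> A" and F: "F \<in> Fam E A" for a F
  proof -
    let ?S = "{y. F y \<noteq> {}}"
    have S: "?S \<subseteq> A" by (rule supp_Fam[OF F])
    have FE: "F y \<subseteq> E" for y using FamD(1)[OF F] .
    let ?Y = "e ` insert a ?S"
    have Y: "?Y \<subseteq> E" using S a eA by blast
    have UE: "(\<Union>y\<in>A. F y) \<subseteq> E" "(\<Union>y\<in>?S. F y) \<subseteq> E" using FE by blast+
    have "canonical A e a (\<Union>y\<in>A. F y) = dE (insert (e a) (\<Union>y\<in>A. F y))"
      using a UE by (simp add: canonical_def)
    also have "\<dots> \<le> dE (?Y \<union> (\<Union>y\<in>?S. F y))"
      using Y UE fin by (intro diversity_mono[OF div]) auto
    also have "\<dots> \<le> dE ?Y + (\<Sum>y\<in>?S. dE (insert (e y) (F y)))"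
      using Y FE fin finite_subset[OF S finA] by (intro diversity_star[OF div]) auto
    also have "(\<Sum>y\<in>?S. dE (insert (e y) (F y))) = (\<Sum>y\<in>A. dE (insert (e y) (F y)))"
      using finA S eA dE_singleton by (intro sum.mono_neutral_left) auto
    also have "\<dots> = (\<Sum>y\<in>A. canonical A e y (F y))"
      using FE by (intro sum.cong) (auto simp: canonical_def)
    also have "dE ?Y = d (insert a ?S)" using dA S a by simp
    finally show ?thesis by simp
  qed
  ultimately show ?thesis by (auto simp: Pat_def)
qed

text \<open>
  Among all patterns separating \<open>c\<close> from a point \<open>a\<close> preceding it, those up to
  \<open>marker A c\<close> are constantly maximal at \<open>a\<close>.
\<close>

definition marker :: "'b set \<Rightarrow> 'b \<Rightarrow> 'b \<Rightarrow> 'a set \<Rightarrow> real" where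
  "marker A c = restrict (\<lambda>x. if x = c then restrict (\<lambda>C. if C = {} then 0 else M') (Pow E) else topf) A"

text \<open>At nonempty sets all values lie between \<open>M'\<close> and \<open>M\<close>. A
  support with a point other than \<open>a\<close> contributes at least \<open>M - M'\<close>, which
  is all that can be missing; a family concentrated at \<open>a\<close> needs no
  contribution.\<close>

lemma marker_Pat:
  assumes iso: "isometry A d e"
  shows "marker A c \<in> Pat A d"
proof -
  have finA: "finite A" by (rule isometry_finite[OF iso])
  have mQ: "marker A c \<in> A \<rightarrow>\<^sub>E Q" using two_valued_Q[OF M'_V M_le] topf_Q by (auto simp: marker_def)
  have val: "marker A c x C \<le> M" "C \<noteq> {} \<Longrightarrow> M' \<le> marker A c x C" if "x \<in> A" "C \<subseteq> E" for x C
    using that M'_less V_nonneg[OF M_V] by (auto simp: marker_def topf_def)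
  have pos: "0 \<le> marker A c x C" if "x \<in> A" "C \<subseteq> E" for x C
  proof -
    have "marker A c x \<in> Q" using mQ that by auto
    then show ?thesis using Q_V V_nonneg that by blast
  qed
  have "marker A c a (\<Union>y\<in>A. F y) \<le> (\<Sum>y\<in>A. marker A c y (F y)) + d (insert a {y. F y \<noteq> {}})"
    if a: "a \<in> A" and F: "F \<in> Fam E A" for a F
  proof -
    have S: "{y. F y \<noteq> {}} \<subseteq> A" by (rule supp_Fam[OF F])
    have FE: "F y \<subseteq> E" for y using FamD(1)[OF F] .
    have mem: "marker A c y (F y) \<le> (\<Sum>y\<in>A. marker A c y (F y))" if "y \<in> A" for y
      using that finA pos FE by (intro member_le_sum) auto
    show ?thesis
    proof (cases "\<exists>y. y \<noteq> a \<and> F y \<noteq> {}")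
      case True
      then obtain y where y: "y \<noteq> a" "F y \<noteq> {}" by blast
      then have yA: "y \<in> A" using S by blast
      have "M - M' \<le> d (insert a {y. F y \<noteq> {}})"
        using y yA S a by (intro isometry_ge[OF iso, of _ a y]) auto
      moreover have "M' \<le> (\<Sum>y\<in>A. marker A c y (F y))"
        using val(2)[OF yA FE y(2)] mem[OF yA] by simp
      moreover have "marker A c a (\<Union>y\<in>A. F y) \<le> M" using FE by (intro val a) blast
      ultimately show ?thesis by simp
    next
      case False
      then have "(\<Union>y\<in>A. F y) = (\<Union>y\<in>A. if y = a then F a else {})" by (intro SUP_cong) auto
      also have "\<dots> = F a" using a by auto
      finally have "(\<Union>y\<in>A. F y) = F a" .
      moreover have "0 \<le> d (insert a {y. F y \<noteq> {}})"
        using S a by (intro V_nonneg isometry_V[OF iso]) auto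
      ultimately show ?thesis using mem[OF a] by simp
    qed
  qed
  then show ?thesis using mQ by (auto simp: Pat_def)
qed

text \<open>The marker of \<open>b\<close> separates the two points, and by rigidity a pattern
  listed after it can occur in \<open>w\<close> only once the marker has occurred. So the first
  separating pattern is the marker or is listed before it.\<close>

lemma first_separating_pattern:
  assumes iso: "isometry A d e" and ab: "a \<in> A" "b \<in> A" "\<rho> a < \<rho> b"
    and ps: "set ps = Pat A d" "sorted_wrt (pat_less \<rho> A) ps" and w: "param_word 0 w (length ps)"
  obtains i where "i < length w" "(ps ! (w ! i)) a = topf" "(ps ! (w ! i)) b \<noteq> topf"
    "\<And>j. j < i \<Longrightarrow> (ps ! (w ! j)) a = (ps ! (w ! j)) b"
proof -
  let ?p0 = "marker A b"
  let ?S = "\<lambda>i. i < length w \<and> (ps ! (w ! i)) a \<noteq> (ps ! (w ! i)) b"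
  have setw: "set w = {..<length ps}" by (rule param_word_set_eq[OF w])
  have E: "E \<noteq> {}" using iso ab by (auto simp: isometry_def)
  have p0a: "?p0 a = topf" and p0b: "?p0 b = restrict (\<lambda>C. if C = {} then 0 else M') (Pow E)"
    using ab by (auto simp: marker_def)
  have "?p0 b E \<noteq> topf E" using E M'_less unfolding p0b topf_def by simp
  then have p0: "?p0 b \<noteq> topf" by auto
  obtain g where g: "g < length ps" "ps ! g = ?p0"
    using marker_Pat[OF iso, of b] ps(1) by (metis in_set_conv_nth)
  then obtain ig where ig: "ig < length w" "w ! ig = g" using setw by (metis in_set_conv_nth lessThan_iff)
  have ex: "?S ig" using ig g p0 p0a by simp
  define i where "i = (LEAST i. ?S i)"
  have i: "?S i" unfolding i_def using ex by (rule LeastI)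
  have least: "(ps ! (w ! j)) a = (ps ! (w ! j)) b" if "j < i" for j
    using not_less_Least[of j ?S] that i unfolding i_def by simp
  define p where "p = ps ! (w ! i)"
  have wi: "w ! i < length ps" using setw i by (metis lessThan_iff nth_mem)
  have pP: "p \<in> Pat A d" unfolding p_def using wi ps(1) nth_mem by blast
  have le: "w ! i \<le> g"
  proof (rule ccontr)
    assume "\<not> w ! i \<le> g"
    then obtain j where "j < i" "w ! j = g" using param_word_growth[OF w, of i g] i by auto
    then show False using least[of j] g p0 p0a by simp
  qed
  have top: "p a = topf"
  proof (cases "w ! i = g")
    case True
    then show ?thesis using g p0a by (simp add: p_def)
  next
    case False
    then have "pat_less \<rho> A p ?p0"
      using sorted_wrt_nth_less[OF ps(2), of "w ! i" g] le g by (simp add: p_def)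
    let ?\<kappa> = "\<lambda>(v, a, C). (v, \<rho> a, \<iota> C)" and ?K = "V \<times> A \<times> Pow E"
      and ?h = "\<lambda>(v, a, C). p a C \<le> v" and ?h' = "\<lambda>(v, a, C). ?p0 a C \<le> v"
    obtain k where k': "k \<in> ?K" "?h k < ?h' k" "\<forall>j\<in>?K. ?\<kappa> j < ?\<kappa> k \<longrightarrow> ?h j = ?h' j"
      using \<open>pat_less \<rho> A p ?p0\<close> unfolding pat_less_def lex_less_def by (elim bexE conjE) (rule that)
    then obtain v x C where kk: "k = (v, x, C)" and k: "v \<in> V" "x \<in> A" "C \<subseteq> E" "\<not> p x C \<le> v" "?p0 x C \<le> v"
      by (cases k) auto
    \<comment> \<open>The first difference from the marker is on a level below \<open>M\<close>,
      where at nonempty sets only the values at \<open>b\<close> matter; so it is on level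
      \<open>M'\<close> at \<open>b\<close>. The entries of that level at \<open>a\<close> come
      earlier because \<open>\<rho> a < \<rho> b\<close>, hence they agree with those of the
      marker.\<close>
    have vM: "v < M" using k V_le[OF Q_V[OF Pat_Q[OF pP k(2)] k(3)]] by simp
    have "C \<noteq> {}" using k(4) Q_empty[OF Pat_Q[OF pP k(2)]] V_nonneg[OF k(1)] by auto
    then have xb: "x = b" and "M' \<le> v"
      using k vM by (auto simp: marker_def topf_def split: if_splits)
    then have v: "v = M'" using V_below[OF k(1) vM] by simp
    show ?thesis
    proof (rule Q_eqI[OF Pat_Q[OF pP ab(1)] topf_Q])
      fix C' assume C': "C' \<subseteq> E"
      show "p a C' = topf C'"
      proof (cases "C' = {}")
        case True
        then show ?thesis using Q_empty[OF Pat_Q[OF pP ab(1)]] by (simp add: topf_def)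
      next
        case False
        have "?h (M', a, C') = ?h' (M', a, C')"
          using k'(3) ab C' M'_V unfolding kk xb v by (intro k'(3)[unfolded kk xb v, rule_format]) auto
        then have "\<not> p a C' \<le> M'" using False C' M'_less p0a by (auto simp: topf_def)
        moreover have "p a C' \<in> V" by (rule Q_V[OF Pat_Q[OF pP ab(1)] C'])
        ultimately have "p a C' = M" using V_below V_le by (meson antisym not_le)
        then show ?thesis using False C' by (simp add: topf_def)
      qed
    qed
  qed
  moreover have "p b \<noteq> topf" using i top by (auto simp: p_def)
  ultimately show thesis using that[of i] i least by (simp add: p_def)
qed

text \<open>All coordinates are patterns, which bounds the gap from above. By surjectivity of
  \<open>w\<close> one coordinate is the canonical pattern, and testing it on the singletons
  \<open>{e y}\<close> gives the lower bound.\<close>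

lemma gap_image:
  assumes iso: "isometry A d e" and ps: "set ps = Pat A d" and w: "param_word 0 w (length ps)"
    and ne: "w \<noteq> []" and inj: "inj_on \<Phi> A" and X: "X \<subseteq> A"
    and \<phi>: "\<And>i a. i < length w \<Longrightarrow> a \<in> A \<Longrightarrow> \<phi> i (\<Phi> a) = (ps ! (w ! i)) a"
  shows "gap E {..<length w} \<phi> (\<Phi> ` X) = d X"
proof (cases "X = {}")
  case True
  have "d {} = dE {}" using iso by (simp add: isometry_def)
  also have "\<dots> = 0" using diversity_eq_0[OF div, of "{}"] by simp
  finally show ?thesis using True by (simp add: gap_def)
next
  case False
  have finX: "finite X" using X isometry_finite[OF iso] finite_subset by blast
  have injX: "inj_on \<Phi> X" using inj X inj_on_subset by blast
  have setw: "set w = {..<length ps}" by (rule param_word_set_eq[OF w])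
  have eA: "e ` A \<subseteq> E" using iso by (simp add: isometry_def)
  have reix: "(\<Sum>z\<in>\<Phi> ` X. \<phi> i z (G z)) = (\<Sum>y\<in>X. (ps ! (w ! i)) y (G (\<Phi> y)))"
    if "i < length w" for i G
    unfolding sum.reindex[OF injX] using X \<phi>[OF that] by (intro sum.cong) auto
  show ?thesis
  proof (rule antisym)
    have "\<phi> i (\<Phi> a) (\<Union>z\<in>\<Phi> ` X. G z) \<le> (\<Sum>z\<in>\<Phi> ` X. \<phi> i z (G z)) + d X"
      if i: "i < length w" and a: "a \<in> X" and G: "G \<in> Fam E (\<Phi> ` X)" for i a G
    proof -
      let ?p = "ps ! (w ! i)"
      have p: "?p \<in> Pat A d" using i setw ps by (metis lessThan_iff nth_mem)
      define F where "F y = (if y \<in> X then G (\<Phi> y) else {})" for y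
      have F: "F \<in> Fam E A" using X FamD(1)[OF G] by (intro FamI) (auto simp: F_def)
      have "(\<Union>y\<in>A. F y) = (\<Union>z\<in>X. G (\<Phi> z))" using X by (auto simp: F_def)
      then have "?p a (\<Union>z\<in>X. G (\<Phi> z)) \<le> (\<Sum>y\<in>A. ?p y (F y)) + d (insert a {y. F y \<noteq> {}})"
        using Pat_le[OF p _ F, of a] a X by auto
      also have "(\<Sum>y\<in>A. ?p y (F y)) = (\<Sum>y\<in>X. ?p y (F y))"
        using X isometry_finite[OF iso] Q_empty[OF Pat_Q[OF p]]
        by (intro sum.mono_neutral_right) (auto simp: F_def)
      also have "\<dots> = (\<Sum>z\<in>\<Phi> ` X. \<phi> i z (G z))" unfolding reix[OF i] by (simp add: F_def)
      also have "d (insert a {y. F y \<noteq> {}}) \<le> d X"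
        using a X by (intro isometry_mono[OF iso]) (auto simp: F_def split: if_splits)
      finally show ?thesis using \<phi>[OF i] a X by auto
    qed
    then show "gap E {..<length w} \<phi> (\<Phi> ` X) \<le> d X"
      using gap_le_iff[of E "{..<length w}" "\<Phi> ` X" \<phi> "d X"] finE ne finX False by auto
  next
    let ?p = "canonical A e"
    obtain g where g: "g < length ps" "ps ! g = ?p"
      using canonical_Pat[OF iso] ps by (metis in_set_conv_nth)
    then obtain i where i: "i < length w" "w ! i = g" using setw by (metis in_set_conv_nth lessThan_iff)
    obtain a where a: "a \<in> X" using False by blast
    define G where "G z = e ` {y \<in> X. \<Phi> y = z}" for z
    have G: "G \<in> Fam E (\<Phi> ` X)" using X eA by (intro FamI) (auto simp: G_def)
    have Ge: "G (\<Phi> y) = {e y}" if "y \<in> X" for y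
    proof -
      have "{y' \<in> X. \<Phi> y' = \<Phi> y} = {y}" using injX that by (auto dest: inj_onD)
      then show ?thesis by (simp add: G_def)
    qed
    have U: "(\<Union>z\<in>\<Phi> ` X. G z) = e ` X" by (auto simp: G_def)
    have "\<phi> i (\<Phi> a) (\<Union>z\<in>\<Phi> ` X. G z) \<le> (\<Sum>z\<in>\<Phi> ` X. \<phi> i z (G z)) + gap E {..<length w} \<phi> (\<Phi> ` X)"
      using finE finX i a G by (intro le_gap) auto
    moreover have "(\<Sum>z\<in>\<Phi> ` X. \<phi> i z (G z)) = 0"
    proof -
      have "?p y {e y} = 0" if "y \<in> X" for y
        using that X eA dE_singleton[of "e y"] by (auto simp: canonical_def)
      then show ?thesis unfolding reix[OF i(1)] using Ge g i by simp
    qed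
    moreover have "\<phi> i (\<Phi> a) (\<Union>z\<in>\<Phi> ` X. G z) = d X"
    proof -
      have "?p a (e ` X) = dE (e ` X)"
        using a X eA by (auto simp: canonical_def insert_absorb)
      then show ?thesis unfolding U using \<phi>[OF i(1), of a] a X g i iso by (auto simp: isometry_def)
    qed
    ultimately show "d X \<le> gap E {..<length w} \<phi> (\<Phi> ` X)" by simp
  qed
qed

text \<open>Each pattern \<open>q\<close> on \<open>A\<close> is the restriction of its extension,
  which gives surjectivity. If \<open>q\<close> precedes the restriction of \<open>p\<close>, then
  by \<open>pat_less_extension\<close> the extension of \<open>q\<close> precedes \<open>p\<close>,
  so the letter of \<open>q\<close> has already occurred: this is rigidity.\<close>

lemma restriction_param_word:
  assumes iso: "isometry A d e"
    and mono: "\<And>a a'. a \<in> A \<Longrightarrow> a' \<in> A \<Longrightarrow> \<sigma> (e a) < \<sigma> (e a') \<longleftrightarrow> \<rho> a < (\<rho> a' :: nat)"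
    and inj: "inj_on \<rho> A" "inj_on \<sigma> E"
    and ps: "set ps = Pat E dE" "sorted_wrt (pat_less \<sigma> E) ps"
    and qs: "set qs = Pat A d" "distinct qs" "sorted_wrt (pat_less \<rho> A) qs"
  obtains u where "length u = length ps" "param_word 0 u (length qs)"
    "\<And>j. j < length ps \<Longrightarrow> compose A (ps ! j) e = qs ! (u ! j)"
proof -
  have "\<forall>j\<in>{..<length ps}. \<exists>i. i < length qs \<and> qs ! i = compose A (ps ! j) e"
    using compose_Pat[OF iso] ps(1) qs(1) by (metis in_set_conv_nth lessThan_iff)
  from bchoice[OF this] obtain f where
    f: "\<And>j. j < length ps \<Longrightarrow> f j < length qs \<and> qs ! f j = compose A (ps ! j) e" by auto
  define u where "u = map f [0..<length ps]"
  have len: "length u = length ps" by (simp add: u_def)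
  have uj: "u ! j < length qs" "qs ! (u ! j) = compose A (ps ! j) e" if "j < length ps" for j
    using f[OF that] that by (auto simp: u_def)
  have preimage: "\<exists>j<length ps. ps ! j = extension A (qs ! c) e \<and> u ! j = c" if c: "c < length qs" for c
  proof -
    have q: "qs ! c \<in> Pat A d" using c qs(1) nth_mem by blast
    obtain j where j: "j < length ps" "ps ! j = extension A (qs ! c) e"
      using extension_Pat[OF iso q] ps(1) by (metis in_set_conv_nth)
    have "qs ! (u ! j) = qs ! c" using uj(2)[OF j(1)] j(2) compose_extension[OF iso q] by simp
    then have "u ! j = c" using qs(2) uj(1)[OF j(1)] c by (simp add: nth_eq_iff_index_eq)
    then show ?thesis using j by blast
  qed
  have "param_word 0 u (length qs)"
  proof (rule param_wordI)
    fix i c assume i: "i < length u" and c: "c < u ! i"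
    have ui: "u ! i < length qs" using uj(1) i len by simp
    then have c': "c < length qs" using c by simp
    then have q: "qs ! c \<in> Pat A d" using qs(1) nth_mem by blast
    have p: "ps ! i \<in> Pat E dE" using i len ps(1) nth_mem by metis
    have l: "pat_less \<rho> A (qs ! c) (compose A (ps ! i) e)"
      using sorted_wrt_nth_less[OF qs(3) c ui] uj(2)[of i] i len by simp
    have less: "pat_less \<sigma> E (extension A (qs ! c) e) (ps ! i)"
      by (rule pat_less_extension[OF iso q p _ inj l]) (rule mono)
    obtain j where j: "j < length ps" "ps ! j = extension A (qs ! c) e" "u ! j = c"
      using preimage[OF c'] by blast
    have "j < i"
    proof (rule ccontr)
      assume "\<not> j < i"
      then consider "j = i" | "i < j" by linarith
      then show False
      proof cases
        case 1
        then show False using less j lex_less_irrefl unfolding pat_less_def by metis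
      next
        case 2
        have "pat_less \<sigma> E (ps ! i) (ps ! j)" by (rule sorted_wrt_nth_less[OF ps(2) 2 j(1)])
        then have "pat_less \<sigma> E (ps ! i) (ps ! i)"
          using less lex_less_trans[OF inj_key[OF inj(2)]] unfolding j(2) pat_less_def by blast
        then show False using lex_less_irrefl unfolding pat_less_def by metis
      qed
    qed
    then show "\<exists>j<i. u ! j = c" using j by blast
  next
    have "c \<in> set u" if "c < length qs" for c using preimage[OF that] len by (metis nth_mem)
    moreover have "c < length qs" if "c \<in> set u" for c
      using that uj(1) len by (metis in_set_conv_nth)
    ultimately show "set u = {..<length qs}" by auto
  qed
  then show thesis using that[of u] len uj by simp
qed

end

section \<open>The Ramsey property\<close>

lemma ordered_embeddings_compose:
  assumes "e \<in> ordered_embeddings A d lt B dB ltB" "f \<in> ordered_embeddings B dB ltB T D ltT"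
  shows "compose A f e \<in> ordered_embeddings A d lt T D ltT"
proof -
  have e: "e \<in> A \<rightarrow>\<^sub>E B" "inj_on e A" "\<And>X. X \<subseteq> A \<Longrightarrow> dB (e ` X) = d X"
    "\<And>a a'. a \<in> A \<Longrightarrow> a' \<in> A \<Longrightarrow> ltB (e a) (e a') \<longleftrightarrow> lt a a'"
    using assms(1) by (auto simp: ordered_embeddings_def)
  have f: "f \<in> B \<rightarrow>\<^sub>E T" "inj_on f B" "\<And>X. X \<subseteq> B \<Longrightarrow> D (f ` X) = dB X"
    "\<And>a a'. a \<in> B \<Longrightarrow> a' \<in> B \<Longrightarrow> ltT (f a) (f a') \<longleftrightarrow> ltB a a'"
    using assms(2) by (auto simp: ordered_embeddings_def)
  have eB: "e a \<in> B" if "a \<in> A" for a using e(1) that by auto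
  have "D (compose A f e ` X) = d X" if "X \<subseteq> A" for X
  proof -
    have "compose A f e ` X = f ` e ` X" using that by (force simp: compose_def)
    moreover have "e ` X \<subseteq> B" using eB that by blast
    ultimately show ?thesis using f(3) e(3)[OF that] by simp
  qed
  moreover have "inj_on (compose A f e) A"
    using e(2) f(2) eB by (auto simp: compose_def inj_on_def)
  moreover have "compose A f e \<in> A \<rightarrow>\<^sub>E T" using eB f(1) by (auto simp: compose_def)
  ultimately show ?thesis using e(4) f(4) eB by (auto simp: ordered_embeddings_def compose_def)
qed

context scale
begin

lemma isometry_ordered_embedding:
  assumes "finite A" "e \<in> ordered_embeddings A d lt E dE lt'"
  shows "isometry A d e"
  using assms by (auto simp: isometry_def ordered_embeddings_def)

text \<open>The coding \<open>\<Psi>\<close> turns rigid surjections onto patterns into embeddings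
  and respects composition: \<open>e\<close> acts on patterns as the rigid surjection
  \<open>u\<close>, so the copies of \<open>A\<close> inside the coded copy of \<open>E\<close> come
  from composites \<open>u \<circ> w\<close>, to which the dual Ramsey theorem applies.\<close>

theorem ordered_ramsey:
  fixes A :: "'a set" and \<rho> \<sigma> :: "'a \<Rightarrow> nat"
  assumes finA: "finite A" and inj: "inj_on \<rho> A" "inj_on \<sigma> E"
    and e0: "e0 \<in> ordered_embeddings A d (\<lambda>x y. \<rho> x < \<rho> y) E dE (\<lambda>x y. \<sigma> x < \<sigma> y)"
  shows "\<exists>(T :: 'c::infinite set) D lt. finite T \<and> diversity T D \<and> (\<forall>x. \<not> lt x x) \<and>
    (\<forall>x y z. lt x y \<longrightarrow> lt y z \<longrightarrow> lt x z) \<and> (\<forall>x\<in>T. \<forall>y\<in>T. x \<noteq> y \<longrightarrow> lt x y \<or> lt y x) \<and>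
    (\<forall>\<chi> :: ('a \<Rightarrow> 'c) \<Rightarrow> nat. (\<forall>f. \<chi> f \<le> 1) \<longrightarrow>
      (\<exists>f\<in>ordered_embeddings E dE (\<lambda>x y. \<sigma> x < \<sigma> y) T D lt.
        \<exists>c. \<forall>e\<in>ordered_embeddings A d (\<lambda>x y. \<rho> x < \<rho> y) E dE (\<lambda>x y. \<sigma> x < \<sigma> y).
          \<chi> (compose A f e) = c))"
proof -
  \<comment> \<open>The embedding \<open>e0\<close> provides the canonical pattern on
    \<open>A\<close>, so the list \<open>qs\<close> is nonempty.\<close>
  have isoA: "isometry A d e0" by (rule isometry_ordered_embedding[OF finA e0])
  have isoE: "isometry E dE (\<lambda>x. x)" using finE by (simp add: isometry_def)
  obtain ps where ps: "set ps = Pat E dE" "distinct ps" "sorted_wrt (pat_less \<sigma> E) ps"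
    using ex_sorted_Pat[OF finE inj(2)] by blast
  obtain qs where qs: "set qs = Pat A d" "distinct qs" "sorted_wrt (pat_less \<rho> A) qs"
    using ex_sorted_Pat[OF finA inj(1)] by blast
  have lp: "length ps \<ge> 1" and lq: "length qs \<ge> 1"
    using canonical_Pat[OF isoE] canonical_Pat[OF isoA] ps(1) qs(1)
    by (auto simp: Suc_le_eq)
  obtain n where n: "\<forall>\<chi> :: nat list \<Rightarrow> nat. (\<forall>x. \<chi> x \<le> 1) \<longrightarrow>
    (\<exists>w c. length w = n \<and> param_word 0 w (length ps) \<and>
      (\<forall>u. length u = length ps \<and> param_word 0 u (length qs) \<longrightarrow> \<chi> (map ((!) u) w) = c))"
    using dual_ramsey[OF lq lp, of 1] by blast
  have n0: "n \<noteq> 0"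
  proof
    assume "n = 0"
    then have "param_word 0 [] (length ps)" using n[rule_format, of "\<lambda>_. 0"] by auto
    then show False using lp by simp
  qed
  define W where "W = {xs. set xs \<subseteq> Q \<and> length xs = n}"
  have finW: "finite W" unfolding W_def by (rule finite_lists_length_eq[OF finite_Q])
  \<comment> \<open>The type of the vertices is prescribed, so the words are copied into it and read
    back through \<open>h\<close>.\<close>
  obtain T :: "'c set" where T: "finite T" "card T = card W"
    using infinite_arbitrarily_large[OF infinite_UNIV] by metis
  obtain h where h: "bij_betw h T W" using finite_same_card_bij[OF T(1) finW T(2)] by blast
  define g where "g = inv_into T h"
  have hW: "h x \<in> W" if "x \<in> T" for x using h that by (auto simp: bij_betw_def)
  have gT: "g xs \<in> T" and hg: "h (g xs) = xs" if "xs \<in> W" for xs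
    using h that unfolding g_def by (auto simp: bij_betw_def inv_into_into f_inv_into_f)
  have hinj: "x = y" if "x \<in> T" "y \<in> T" "h x = h y" for x y
    using h that by (auto simp: bij_betw_def dest: inj_onD)
  obtain \<tau>0 where \<tau>0: "bij_betw \<tau>0 Q {0..<card Q}" using ex_bij_betw_finite_nat[OF finite_Q] by blast
  \<comment> \<open>With \<open>topf\<close> first, the letters found by
    \<open>first_separating_pattern\<close> compare in the right direction.\<close>
  define \<tau> where "\<tau> f = (if f = topf then 0 else Suc (\<tau>0 f))" for f
  have \<tau>: "inj_on \<tau> Q" using \<tau>0 by (auto simp: \<tau>_def inj_on_def bij_betw_def)
  define \<phi> where "\<phi> i x = h x ! i" for i x
  have \<phi>Q: "\<phi> i x \<in> Q" if "i < n" "x \<in> T" for i x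
    using hW[OF that(2)] that(1) by (auto simp: \<phi>_def W_def subset_iff)
  define D where "D = gap E {..<n} \<phi>"
  define lt where "lt x y = lex_less (\<lambda>i. i) {..<n} (\<lambda>i. \<tau> (\<phi> i x)) (\<lambda>i. \<tau> (\<phi> i y))" for x y
  have differ: "\<exists>i<n. \<phi> i x \<noteq> \<phi> i y" if "x \<in> T" "y \<in> T" "x \<noteq> y" for x y
  proof (rule ccontr)
    assume "\<not> (\<exists>i<n. \<phi> i x \<noteq> \<phi> i y)"
    then have "h x = h y" using hW that by (intro nth_equalityI) (auto simp: \<phi>_def W_def)
    then show False using hinj that by blast
  qed
  have divT: "diversity T D" unfolding D_def
  proof (rule diversity_gap)
    show "\<exists>i\<in>{..<n}. \<exists>C\<subseteq>E. \<phi> i x C \<noteq> \<phi> i y C" if "x \<in> T" "y \<in> T" "x \<noteq> y" for x y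
      using differ[OF that] Q_eqI[OF \<phi>Q \<phi>Q] that by (meson lessThan_iff)
  qed (use finE T n0 \<phi>Q Q_subadditive in auto)
  have irrefl: "\<not> lt x x" for x unfolding lt_def by (rule lex_less_irrefl)
  have trans: "lt x z" if "lt x y" "lt y z" for x y z
    using that unfolding lt_def by (rule lex_less_trans[rotated]) simp
  have total: "lt x y \<or> lt y x" if xy: "x \<in> T" "y \<in> T" "x \<noteq> y" for x y
  proof -
    obtain i where i: "i < n" "\<phi> i x \<noteq> \<phi> i y" using differ[OF xy] by blast
    then have "\<tau> (\<phi> i x) \<noteq> \<tau> (\<phi> i y)" using \<tau> \<phi>Q xy by (auto dest: inj_onD)
    then show ?thesis unfolding lt_def using i by (intro lex_less_total[where k = i]) auto
  qed
  define \<Psi> where "\<Psi> B rs w = restrict (\<lambda>a. g (map (\<lambda>j. (rs ! j) a) w)) B"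
    for B :: "'a set" and rs :: "('a \<Rightarrow> 'a set \<Rightarrow> real) list" and w
  have \<Psi>: "\<Psi> B rs w \<in> ordered_embeddings B dB (\<lambda>x y. \<mu> x < \<mu> y) T D lt"
    if iso: "isometry B dB e" and rs: "set rs = Pat B dB" "sorted_wrt (pat_less \<mu> B) rs"
      and w: "param_word 0 w (length rs)" "length w = n" and inj: "inj_on \<mu> B"
    for B dB e \<mu> rs w
  proof -
    have rsP: "rs ! (w ! i) \<in> Pat B dB" if "i < n" for i
      using param_word_set_eq[OF w(1)] w(2) rs(1) that by (metis lessThan_iff nth_mem)
    have wW: "map (\<lambda>j. (rs ! j) a) w \<in> W" if "a \<in> B" for a
      using Pat_Q[OF rsP that] w(2) by (auto simp: W_def in_set_conv_nth)
    have \<phi>\<Psi>: "\<phi> i (\<Psi> B rs w a) = (rs ! (w ! i)) a" if "i < n" "a \<in> B" for i a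
      using hg[OF wW[OF that(2)]] that w(2) by (simp add: \<phi>_def \<Psi>_def)
    have less: "lt (\<Psi> B rs w a) (\<Psi> B rs w b)" if ab: "a \<in> B" "b \<in> B" "\<mu> a < \<mu> b" for a b
    proof -
      obtain i where i: "i < n" "(rs ! (w ! i)) a = topf" "(rs ! (w ! i)) b \<noteq> topf"
        "\<And>j. j < i \<Longrightarrow> (rs ! (w ! j)) a = (rs ! (w ! j)) b"
        using first_separating_pattern[OF iso ab rs w(1)] w(2) by metis
      then show ?thesis unfolding lt_def lex_less_def
        using ab \<phi>\<Psi> by (intro bexI[of _ i]) (auto simp: \<tau>_def)
    qed
    have iff: "lt (\<Psi> B rs w a) (\<Psi> B rs w b) \<longleftrightarrow> \<mu> a < \<mu> b" if ab: "a \<in> B" "b \<in> B" for a b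
    proof
      assume l: "lt (\<Psi> B rs w a) (\<Psi> B rs w b)"
      show "\<mu> a < \<mu> b"
      proof (rule ccontr)
        assume "\<not> \<mu> a < \<mu> b"
        then consider "\<mu> b < \<mu> a" | "\<mu> a = \<mu> b" by linarith
        then show False
        proof cases
          case 1
          then show False using less[OF ab(2,1)] l trans irrefl by blast
        next
          case 2
          then have "a = b" using inj ab by (auto dest: inj_onD)
          then show False using l irrefl by blast
        qed
      qed
    qed (use less ab in blast)
    have inj\<Psi>: "inj_on (\<Psi> B rs w) B"
    proof (rule inj_onI)
      fix a b assume ab: "a \<in> B" "b \<in> B" "\<Psi> B rs w a = \<Psi> B rs w b"
      have "\<not> \<mu> a < \<mu> b" "\<not> \<mu> b < \<mu> a" using less[of a b] less[of b a] ab irrefl by auto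
      then show "a = b" using inj ab by (auto dest: inj_onD)
    qed
    have "D (\<Psi> B rs w ` X) = dB X" if "X \<subseteq> B" for X
    proof -
      have "w \<noteq> []" using w(2) n0 by auto
      then show ?thesis unfolding D_def w(2)[symmetric]
        using gap_image[OF iso rs(1) w(1) _ inj\<Psi> that] \<phi>\<Psi> w(2) by simp
    qed
    moreover have "\<Psi> B rs w \<in> B \<rightarrow>\<^sub>E T" using gT wW by (auto simp: \<Psi>_def)
    ultimately show ?thesis using inj\<Psi> iff by (auto simp: ordered_embeddings_def)
  qed
  have ramsey: "\<exists>f\<in>ordered_embeddings E dE (\<lambda>x y. \<sigma> x < \<sigma> y) T D lt.
        \<exists>c. \<forall>e\<in>ordered_embeddings A d (\<lambda>x y. \<rho> x < \<rho> y) E dE (\<lambda>x y. \<sigma> x < \<sigma> y).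
          \<chi> (compose A f e) = c"
    if \<chi>: "\<forall>f. \<chi> f \<le> 1" for \<chi> :: "('a \<Rightarrow> 'c) \<Rightarrow> nat"
  proof -
    obtain w c where w: "length w = n" "param_word 0 w (length ps)"
      and c: "\<And>u. length u = length ps \<Longrightarrow> param_word 0 u (length qs) \<Longrightarrow>
        \<chi> (\<Psi> A qs (map ((!) u) w)) = c"
      using n[rule_format, of "\<lambda>v. \<chi> (\<Psi> A qs v)", OF \<chi>[rule_format]] by blast
    show ?thesis
    proof (intro bexI exI ballI)
      show "\<Psi> E ps w \<in> ordered_embeddings E dE (\<lambda>x y. \<sigma> x < \<sigma> y) T D lt"
        by (rule \<Psi>[OF isoE ps(1,3) w(2,1) inj(2)])
      fix e assume e: "e \<in> ordered_embeddings A d (\<lambda>x y. \<rho> x < \<rho> y) E dE (\<lambda>x y. \<sigma> x < \<sigma> y)"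
      have iso: "isometry A d e" by (rule isometry_ordered_embedding[OF finA e])
      have mono: "\<sigma> (e a) < \<sigma> (e a') \<longleftrightarrow> \<rho> a < \<rho> a'" if "a \<in> A" "a' \<in> A" for a a'
        using e that by (auto simp: ordered_embeddings_def)
      obtain u where u: "length u = length ps" "param_word 0 u (length qs)"
        "\<And>j. j < length ps \<Longrightarrow> compose A (ps ! j) e = qs ! (u ! j)"
        using restriction_param_word[OF iso mono inj ps(1,3) qs] by blast
      have "compose A (\<Psi> E ps w) e = \<Psi> A qs (map ((!) u) w)"
      proof (rule ext)
        fix a
        show "compose A (\<Psi> E ps w) e a = \<Psi> A qs (map ((!) u) w) a"
        proof (cases "a \<in> A")
          case True
          then have "e a \<in> E" using e by (auto simp: ordered_embeddings_def)
          moreover have "(ps ! j) (e a) = (qs ! (u ! j)) a" if "j \<in> set w" for j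
          proof -
            have "j < length ps" using that param_word_set_eq[OF w(2)] by auto
            from u(3)[OF this] show ?thesis using True by (metis compose_eq)
          qed
          ultimately show ?thesis using True by (simp add: compose_def \<Psi>_def cong: map_cong)
        qed (simp add: compose_def \<Psi>_def)
      qed
      then show "\<chi> (compose A (\<Psi> E ps w) e) = c" using c u by simp
    qed
  qed
  show ?thesis
    by (intro exI[of _ T] exI[of _ D] exI[of _ lt] conjI) (use T divT irrefl trans total ramsey in blast)+
qed

end

section \<open>Choice of the value set\<close>

lemma ex_scale:
  assumes fin: "finite E" and div: "diversity E dE"
  shows "\<exists>V M M' \<iota>. scale E dE V M M' \<iota>"
proof -
  \<comment> \<open>Inserting \<open>1\<close> keeps \<open>S\<close> nonempty when \<open>E\<close>
    has at most one point.\<close>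
  define S where "S = insert 1 (dE ` {X. X \<subseteq> E \<and> card X \<ge> 2})"
  have finS: "finite S" using fin by (simp add: S_def)
  have dpos: "0 < dE X" if "X \<subseteq> E" "card X \<ge> 2" for X
    using diversity_nonneg[OF div, of X] diversity_eq_0[OF div, of X] that fin finite_subset
    by fastforce
  define s where "s = Min S"
  have s: "s \<le> x" if "x \<in> S" for x using finS that by (simp add: s_def)
  have "s \<in> S" unfolding s_def using finS by (intro Min_in) (auto simp: S_def)
  then have s0: "0 < s" using dpos by (auto simp: S_def)
  define m where "m = Max S"
  have m: "x \<le> m" if "x \<in> S" for x using finS that by (simp add: m_def)
  have mS: "m \<in> S" unfolding m_def using finS by (intro Max_in) (auto simp: S_def)
  \<comment> \<open>Twice the maximum is a sum of two elements of \<open>S\<close>, and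
    \<open>M - s\<close> is still at least \<open>s\<close>.\<close>
  define M where "M = 2 * m"
  have sm: "s \<le> m" by (rule s[OF mS])
  \<comment> \<open>The additional value \<open>M - s\<close> ensures \<open>M - s \<le> M'\<close>,
    so \<open>M - M'\<close> is at most \<open>s\<close> and thus at most every nonzero diversity of
    a subset of \<open>E\<close>.\<close>
  define S' where "S' = insert (M - s) S"
  have S': "s \<le> x" if "x \<in> S'" for x using that s sm by (auto simp: S'_def M_def)
  define V where "V = {min M (sum_list xs) | xs. set xs \<subseteq> S'}"
  have sum_ge: "real (length xs) * s \<le> sum_list xs" if "set xs \<subseteq> S'" for xs
    using that
  proof (induction xs)
    case (Cons x xs)
    then show ?case using S'[of x] by (simp add: algebra_simps)
  qed simp
  have sum_pos: "0 \<le> sum_list xs" if "set xs \<subseteq> S'" for xs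
    using sum_ge[OF that] s0 by (meson mult_nonneg_nonneg of_nat_0_le_iff order_less_imp_le order_trans)
  have V_single: "x \<in> V" if "x \<in> S'" "x \<le> M" for x
    unfolding V_def using that by (intro CollectI exI[of _ "[x]"]) simp
  have finV: "finite V"
  proof -
    \<comment> \<open>Summands are at least \<open>s\<close>, so a sum of more than \<open>K\<close>
      of them is truncated to \<open>M\<close>; only short lists give other values.\<close>
    obtain K :: nat where K: "M / s < real K" using reals_Archimedean2 by blast
    have "V \<subseteq> insert M ((\<lambda>xs. min M (sum_list xs)) ` {xs. set xs \<subseteq> S' \<and> length xs \<le> K})"
    proof
      fix v assume "v \<in> V"
      then obtain xs where xs: "set xs \<subseteq> S'" "v = min M (sum_list xs)" by (auto simp: V_def)
      show "v \<in> insert M ((\<lambda>xs. min M (sum_list xs)) ` {xs. set xs \<subseteq> S' \<and> length xs \<le> K})"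
      proof (cases "length xs \<le> K")
        case False
        have "M \<le> real K * s" using K s0 by (simp add: field_simps)
        also have "\<dots> \<le> real (length xs) * s" using False s0 by (intro mult_right_mono) auto
        also have "\<dots> \<le> sum_list xs" by (rule sum_ge[OF xs(1)])
        finally show ?thesis using xs(2) by simp
      qed (use xs in auto)
    qed
    moreover have "finite {xs. set xs \<subseteq> S' \<and> length xs \<le> K}"
      using finS by (intro finite_lists_length_le) (simp add: S'_def)
    ultimately show ?thesis by (meson finite_imageI finite_insert finite_subset)
  qed
  have M0: "0 \<le> M" using sm s0 by (simp add: M_def)
  have V_bounds: "V \<subseteq> {0..M}" using sum_pos M0 by (auto simp: V_def)
  have zero_V: "0 \<in> V" unfolding V_def using M0 by (intro CollectI exI[of _ "[]"]) simp
  have M_V: "M \<in> V" unfolding V_def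
    using mS by (intro CollectI exI[of _ "[m, m]"]) (simp add: M_def S'_def)
  have Ms_V: "M - s \<in> V" using s0 by (intro V_single) (auto simp: S'_def)
  define M' where "M' = Max {v \<in> V. v < M}"
  have finV': "finite {v \<in> V. v < M}" using finV by simp
  have M'_mem: "M' \<in> {v \<in> V. v < M}" unfolding M'_def
    using finV' Ms_V s0 by (intro Max_in) auto
  have V_below: "v \<le> M'" if "v \<in> V" "v < M" for v
    unfolding M'_def using finV' that by (intro Max_ge) auto
  have M's: "M - s \<le> M'" using V_below[OF Ms_V] s0 by simp
  have V_add: "min M (x + y) \<in> V" if xy: "x \<in> V" "y \<in> V" for x y
  proof -
    obtain xs ys where xs: "set xs \<subseteq> S'" "x = min M (sum_list xs)" "set ys \<subseteq> S'" "y = min M (sum_list ys)"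
      using xy by (auto simp: V_def)
    have "min M (x + y) = min M (sum_list (xs @ ys))"
      using xs sum_pos[OF xs(1)] sum_pos[OF xs(3)] M0 by (auto simp: min_def)
    then show ?thesis unfolding V_def using xs by (intro CollectI exI[of _ "xs @ ys"]) auto
  qed
  have dE_V: "dE X \<in> V" if X: "X \<subseteq> E" for X
  proof (cases "card X \<ge> 2")
    case True
    then have "dE X \<in> S" using X by (auto simp: S_def)
    moreover have "dE X \<le> M" using m[OF \<open>dE X \<in> S\<close>] sm s0 by (simp add: M_def)
    ultimately show ?thesis by (intro V_single) (auto simp: S'_def)
  next
    case False
    then have "dE X = 0" using diversity_eq_0[OF div, of X] X fin finite_subset by fastforce
    then show ?thesis using zero_V by simp
  qed
  have dE_ge: "M - M' \<le> dE X" if X: "X \<subseteq> E" "card X \<ge> 2" for X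
    using s[of "dE X"] X M's by (auto simp: S_def)
  obtain \<iota> where \<iota>: "bij_betw \<iota> (Pow E) {0..<card (Pow E)}"
    using ex_bij_betw_finite_nat[of "Pow E"] fin by auto
  have "scale E dE V M M' \<iota>"
    using fin div finV V_bounds zero_V M_V M'_mem V_below V_add dE_V dE_ge \<iota> M's sm
    by unfold_locales (auto simp: bij_betw_def M_def)
  then show ?thesis by blast
qed

section \<open>Translation between relational structures and ordered diversities\<close>

definition order_of :: "('s ord_symbol, 'a) rel_structure \<Rightarrow> 'a \<Rightarrow> 'a \<Rightarrow> bool" where
  "order_of S x y \<longleftrightarrow> [x, y] \<in> interp S Less"

definition carries_diversity :: "((nat \<times> real) ord_symbol, 'a) rel_structure \<Rightarrow> ('a set \<Rightarrow> real) \<Rightarrow> bool" where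
  "carries_diversity S d \<longleftrightarrow> finite (verts S) \<and> diversity (verts S) d \<and>
     (\<forall>n r. n \<ge> 2 \<and> r > 0 \<longrightarrow> interp S (Base (n, r)) =
       {xs. length xs = n \<and> distinct xs \<and> set xs \<subseteq> verts S \<and> d (set xs) = r})"

lemma carries_diversityD:
  assumes "carries_diversity S d"
  shows "finite (verts S)" "diversity (verts S) d"
    "\<And>n r. n \<ge> 2 \<Longrightarrow> r > 0 \<Longrightarrow> interp S (Base (n, r)) =
       {xs. length xs = n \<and> distinct xs \<and> set xs \<subseteq> verts S \<and> d (set xs) = r}"
  using assms unfolding carries_diversity_def by blast+

lemma free_ordering_diversityE:
  assumes "S \<in> free_orderings div_language finite_diversities"
  obtains d where "is_structure (ord_language div_language) S" "carries_diversity S d"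
    "\<And>x. \<not> order_of S x x" "\<And>x y z. order_of S x y \<Longrightarrow> order_of S y z \<Longrightarrow> order_of S x z"
    "\<And>x y. x \<in> verts S \<Longrightarrow> y \<in> verts S \<Longrightarrow> x \<noteq> y \<Longrightarrow> order_of S x y \<or> order_of S y x"
proof -
  have S: "is_structure (ord_language div_language) S"
    "strict_linear_order_on (verts S) {(x, y). [x, y] \<in> interp S Less}"
    "reduct S \<in> finite_diversities"
    using assms by (auto simp: free_orderings_def)
  obtain A d where A: "reduct S = div_structure A d" "finite A" "diversity A d"
    using S(3) by (auto simp: finite_diversities_def)
  have vA: "verts S = A" using arg_cong[OF A(1), of verts] by (simp add: reduct_def div_structure_def)
  have "interp (reduct S) (n, r) = interp (div_structure A d) (n, r)" for n r using A(1) by simp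
  then have "carries_diversity S d"
    using vA A(2,3) by (simp add: carries_diversity_def reduct_def div_structure_def)
  then show thesis
    using S(2) by (intro that[OF S(1)])
      (auto simp: order_of_def strict_linear_order_on_def trans_def irrefl_def total_on_def)
qed

text \<open>A set \<open>X\<close> with at least two points is described by the symbol with arity
  \<open>card X\<close> and value \<open>d X\<close>, applied to an enumeration without repetitions.
  Smaller sets have no symbol, but both diversities vanish on them.\<close>

lemma Emb_diversity:
  assumes "carries_diversity A d" "carries_diversity B d'"
  shows "Emb (ord_language div_language) A B
    = ordered_embeddings (verts A) d (order_of A) (verts B) d' (order_of B)"
proof (intro set_eqI iffI)
  note A = carries_diversityD[OF assms(1)] and B = carries_diversityD[OF assms(2)]
  fix f assume f: "f \<in> Emb (ord_language div_language) A B"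
  have f1: "f \<in> verts A \<rightarrow>\<^sub>E verts B" "inj_on f (verts A)" using f by (auto simp: Emb_def)
  have f2: "xs \<in> interp A s \<longleftrightarrow> map f xs \<in> interp B s"
    if "s \<in> symbols (ord_language div_language)" "length xs = arity (ord_language div_language) s"
      "set xs \<subseteq> verts A" for s xs
    using f that by (auto simp: Emb_def)
  have ord: "order_of B (f a) (f a') \<longleftrightarrow> order_of A a a'" if "a \<in> verts A" "a' \<in> verts A" for a a'
    using f2[of Less "[a, a']"] that by (simp add: ord_language_def order_of_def)
  have "d' (f ` X) = d X" if X: "X \<subseteq> verts A" for X
  proof -
    have finX: "finite X" using X A(1) finite_subset by blast
    have fX: "f ` X \<subseteq> verts B" using f1 X by auto
    have card: "card (f ` X) = card X" using f1(2) X by (intro card_image) (auto intro: inj_on_subset)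
    show ?thesis
    proof (cases "card X \<le> 1")
      case True
      then show ?thesis
        using diversity_eq_0[OF A(2) finX X] diversity_eq_0[OF B(2) _ fX] card finX by simp
    next
      case False
      then have pos: "d X > 0"
        using diversity_nonneg[OF A(2) finX X] diversity_eq_0[OF A(2) finX X] by linarith
      obtain xs where xs: "set xs = X" "distinct xs" using finite_distinct_list[OF finX] by blast
      have len: "length xs = card X" using distinct_card[OF xs(2)] xs(1) by simp
      have "xs \<in> interp A (Base (card X, d X))" using A(3)[of "card X" "d X"] False pos xs len X by simp
      then have "map f xs \<in> interp B (Base (card X, d X))"
        using f2[of "Base (card X, d X)" xs] False pos xs len X
        by (simp add: ord_language_def div_language_def)
      then show ?thesis using B(3)[of "card X" "d X"] False pos xs by simp
    qed
  qed
  then show "f \<in> ordered_embeddings (verts A) d (order_of A) (verts B) d' (order_of B)"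
    using f1 ord by (auto simp: ordered_embeddings_def)
next
  note A = carries_diversityD[OF assms(1)] and B = carries_diversityD[OF assms(2)]
  fix f assume "f \<in> ordered_embeddings (verts A) d (order_of A) (verts B) d' (order_of B)"
  then have f: "f \<in> verts A \<rightarrow>\<^sub>E verts B" "inj_on f (verts A)"
    "\<And>X. X \<subseteq> verts A \<Longrightarrow> d' (f ` X) = d X"
    "\<And>a a'. a \<in> verts A \<Longrightarrow> a' \<in> verts A \<Longrightarrow> order_of B (f a) (f a') \<longleftrightarrow> order_of A a a'"
    by (auto simp: ordered_embeddings_def)
  have "xs \<in> interp A s \<longleftrightarrow> map f xs \<in> interp B s"
    if s: "s \<in> symbols (ord_language div_language)" "length xs = arity (ord_language div_language) s"
      "set xs \<subseteq> verts A" for s xs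
  proof (cases s)
    case Less
    then have "length xs = 2" using s(2) by (simp add: ord_language_def)
    then obtain a a' where "xs = [a, a']" by (auto simp: length_Suc_conv numeral_2_eq_2)
    then show ?thesis using f(4)[of a a'] s(3) Less by (simp add: order_of_def)
  next
    case (Base t)
    then obtain n r where t: "s = Base (n, r)" "n \<ge> 2" "r > 0" "length xs = n"
      using s by (auto simp: ord_language_def div_language_def)
    have "f ` set xs \<subseteq> verts B" using f(1) s(3) by auto
    moreover have "distinct (map f xs) \<longleftrightarrow> distinct xs"
      using f(2) s(3) by (auto simp: distinct_map intro: inj_on_subset)
    ultimately show ?thesis using A(3)[OF t(2,3)] B(3)[OF t(2,3)] f(3)[OF s(3)] t(1,4) s(3) by simp
  qed
  then show "f \<in> Emb (ord_language div_language) A B" using f(1,2) by (auto simp: Emb_def)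
qed

lemma ex_rank:
  assumes "finite A" "\<And>x. \<not> lt x x" "\<And>x y z. lt x y \<Longrightarrow> lt y z \<Longrightarrow> lt x z"
    "\<And>x y. x \<in> A \<Longrightarrow> y \<in> A \<Longrightarrow> x \<noteq> y \<Longrightarrow> lt x y \<or> lt y x"
  obtains \<rho> :: "'a \<Rightarrow> nat" where "inj_on \<rho> A" "\<And>x y. x \<in> A \<Longrightarrow> y \<in> A \<Longrightarrow> lt x y \<longleftrightarrow> \<rho> x < \<rho> y"
proof -
  define \<rho> where "\<rho> x = card {z \<in> A. lt z x}" for x
  have less: "\<rho> x < \<rho> y" if "x \<in> A" "lt x y" for x y
  proof -
    have "{z \<in> A. lt z x} \<subseteq> {z \<in> A. lt z y}" using that assms(3) by blast
    moreover have "x \<in> {z \<in> A. lt z y} - {z \<in> A. lt z x}" using that assms(2) by blast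
    ultimately show ?thesis unfolding \<rho>_def using assms(1) by (intro psubset_card_mono) auto
  qed
  have "lt x y \<longleftrightarrow> \<rho> x < \<rho> y" if "x \<in> A" "y \<in> A" for x y
    using less[of x y] less[of y x] assms(4)[of x y] that by fastforce
  moreover have "inj_on \<rho> A" using less assms(4) by (intro inj_onI) (metis less_irrefl)
  ultimately show thesis using that by blast
qed

lemma ordered_embeddings_cong:
  assumes "\<And>x y. x \<in> A \<Longrightarrow> y \<in> A \<Longrightarrow> lt1 x y \<longleftrightarrow> lt2 x y" "\<And>x y. x \<in> T \<Longrightarrow> y \<in> T \<Longrightarrow> lt1' x y \<longleftrightarrow> lt2' x y"
  shows "ordered_embeddings A d lt1 T D lt1' = ordered_embeddings A d lt2 T D lt2'"
proof -
  have "(\<forall>a\<in>A. \<forall>a'\<in>A. lt1' (f a) (f a') \<longleftrightarrow> lt1 a a') \<longleftrightarrow> (\<forall>a\<in>A. \<forall>a'\<in>A. lt2' (f a) (f a') \<longleftrightarrow> lt2 a a')"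
    if "f \<in> A \<rightarrow>\<^sub>E T" for f
  proof -
    have "f a \<in> T" if "a \<in> A" for a using \<open>f \<in> A \<rightarrow>\<^sub>E T\<close> that by auto
    then show ?thesis using assms by simp
  qed
  then show ?thesis unfolding ordered_embeddings_def by (intro Collect_cong conj_cong refl)
qed

theorem theorem7p11:
  shows "ramsey_class (ord_language div_language)
           (free_orderings div_language
             (finite_diversities :: (nat \<times> real, 'a::infinite) rel_structure set))"
  unfolding ramsey_class_def
proof (intro conjI ballI)
  fix S assume "S \<in> free_orderings div_language (finite_diversities :: (nat \<times> real, 'a) rel_structure set)"
  then obtain d where "is_structure (ord_language div_language) S" "carries_diversity S d"
    by (rule free_ordering_diversityE)
  then show "is_structure (ord_language div_language) S" "finite (verts S)"
    by (simp_all add: carries_diversity_def)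
next
  let ?L = "ord_language div_language"
  let ?K = "free_orderings div_language (finite_diversities :: (nat \<times> real, 'a) rel_structure set)"
  fix A B assume AK: "A \<in> ?K" and BK: "B \<in> ?K"
  obtain dA where A': "carries_diversity A dA"
    and ordA: "\<And>x. \<not> order_of A x x" "\<And>x y z. order_of A x y \<Longrightarrow> order_of A y z \<Longrightarrow> order_of A x z"
    "\<And>x y. x \<in> verts A \<Longrightarrow> y \<in> verts A \<Longrightarrow> x \<noteq> y \<Longrightarrow> order_of A x y \<or> order_of A y x"
    by (rule free_ordering_diversityE[OF AK]) blast
  note A = carries_diversityD[OF A']
  obtain dB where B': "carries_diversity B dB"
    and ordB: "\<And>x. \<not> order_of B x x" "\<And>x y z. order_of B x y \<Longrightarrow> order_of B y z \<Longrightarrow> order_of B x z"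
    "\<And>x y. x \<in> verts B \<Longrightarrow> y \<in> verts B \<Longrightarrow> x \<noteq> y \<Longrightarrow> order_of B x y \<or> order_of B y x"
    by (rule free_ordering_diversityE[OF BK]) blast
  note B = carries_diversityD[OF B']
  obtain \<rho> where \<rho>: "inj_on \<rho> (verts A)"
    "\<And>x y. x \<in> verts A \<Longrightarrow> y \<in> verts A \<Longrightarrow> order_of A x y \<longleftrightarrow> \<rho> x < (\<rho> y :: nat)"
    by (rule ex_rank[of "verts A" "order_of A"]) (use A(1) ordA in blast)+
  obtain \<sigma> where \<sigma>: "inj_on \<sigma> (verts B)"
    "\<And>x y. x \<in> verts B \<Longrightarrow> y \<in> verts B \<Longrightarrow> order_of B x y \<longleftrightarrow> \<sigma> x < (\<sigma> y :: nat)"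
    by (rule ex_rank[of "verts B" "order_of B"]) (use B(1) ordB in blast)+
  have EmbAB: "Emb ?L A B = ordered_embeddings (verts A) dA (\<lambda>x y. \<rho> x < \<rho> y) (verts B) dB (\<lambda>x y. \<sigma> x < \<sigma> y)"
    unfolding Emb_diversity[OF A' B'] by (rule ordered_embeddings_cong) (use \<rho>(2) \<sigma>(2) in auto)
  show "\<exists>C\<in>?K. \<forall>\<chi> \<in> Emb ?L A C \<rightarrow> {0, 1::nat}.
        \<exists>f\<in>Emb ?L B C. \<exists>c. \<forall>e\<in>Emb ?L A B. \<chi> (compose (verts A) f e) = c"
  proof (cases "Emb ?L A B = {}")
    case True
    \<comment> \<open>Without embeddings of \<open>A\<close> into \<open>B\<close> the colour
      condition is vacuous, and \<open>B\<close> itself serves as \<open>C\<close>.\<close>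
    have "restrict (\<lambda>x. x) (verts B) ` X = X" if "X \<subseteq> verts B" for X
      using that by (subst image_cong[where g = "\<lambda>x. x"]) auto
    then have "restrict (\<lambda>x. x) (verts B) \<in> Emb ?L B B"
      unfolding Emb_diversity[OF B' B'] by (simp add: ordered_embeddings_def)
    then show ?thesis using BK True by blast
  next
    case False
    then obtain e0 where e0: "e0 \<in> ordered_embeddings (verts A) dA (\<lambda>x y. \<rho> x < \<rho> y) (verts B) dB (\<lambda>x y. \<sigma> x < \<sigma> y)"
      unfolding EmbAB by blast
    obtain V M M' \<iota> where sc: "scale (verts B) dB V M M' \<iota>" using ex_scale[OF B(1,2)] by blast
    obtain T :: "'a set" and D lt where T: "finite T" "diversity T D" "\<forall>x. \<not> lt x x"
      "\<forall>x y z. lt x y \<longrightarrow> lt y z \<longrightarrow> lt x z" "\<forall>x\<in>T. \<forall>y\<in>T. x \<noteq> y \<longrightarrow> lt x y \<or> lt y x"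
      and ramsey: "\<forall>\<chi> :: ('a \<Rightarrow> 'a) \<Rightarrow> nat. (\<forall>f. \<chi> f \<le> 1) \<longrightarrow>
        (\<exists>f\<in>ordered_embeddings (verts B) dB (\<lambda>x y. \<sigma> x < \<sigma> y) T D lt.
          \<exists>c. \<forall>e\<in>ordered_embeddings (verts A) dA (\<lambda>x y. \<rho> x < \<rho> y) (verts B) dB (\<lambda>x y. \<sigma> x < \<sigma> y).
            \<chi> (compose (verts A) f e) = c)"
      using scale.ordered_ramsey[OF sc A(1) \<rho>(1) \<sigma>(1) e0, where 'c = 'a] by (elim exE conjE) (rule that)
    \<comment> \<open>The relation \<open>lt\<close> is defined on the whole type; it is cut down to
      \<open>T\<close> since a structure may relate vertices only.\<close>
    define C where "C = \<lparr>verts = T, interp = (\<lambda>s. case s of Base t \<Rightarrow> interp (div_structure T D) t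
      | Less \<Rightarrow> {[x, y] | x y. x \<in> T \<and> y \<in> T \<and> lt x y})\<rparr>"
    have vC: "verts C = T" by (simp add: C_def)
    have ordC: "order_of C x y \<longleftrightarrow> x \<in> T \<and> y \<in> T \<and> lt x y" for x y
      by (auto simp: C_def order_of_def)
    have C': "carries_diversity C D"
      using T(1,2) by (simp add: carries_diversity_def C_def div_structure_def)
    have "C \<in> ?K"
    proof -
      have "reduct C = div_structure T D"
        by (simp add: reduct_def C_def div_structure_def)
      then have "reduct C \<in> finite_diversities" using T(1,2) by (auto simp: finite_diversities_def)
      moreover have "{(x, y). [x, y] \<in> interp C Less} = {(x, y). x \<in> T \<and> y \<in> T \<and> lt x y}"
        using ordC by (auto simp: order_of_def)
      moreover have "strict_linear_order_on T {(x, y). x \<in> T \<and> y \<in> T \<and> lt x y}"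
        using T(3-5) by (auto simp: strict_linear_order_on_def trans_def irrefl_def total_on_def)
      moreover have "is_structure ?L C"
        unfolding is_structure_def
        by (auto simp: ord_language_def div_language_def C_def div_structure_def split: ord_symbol.splits if_splits)
      ultimately show ?thesis by (simp add: free_orderings_def vC)
    qed
    moreover have "\<exists>f\<in>Emb ?L B C. \<exists>c. \<forall>e\<in>Emb ?L A B. \<chi> (compose (verts A) f e) = c"
      if \<chi>: "\<chi> \<in> Emb ?L A C \<rightarrow> {0, 1::nat}" for \<chi>
    proof -
      have EmbC: "Emb ?L A C = ordered_embeddings (verts A) dA (\<lambda>x y. \<rho> x < \<rho> y) T D lt"
        "Emb ?L B C = ordered_embeddings (verts B) dB (\<lambda>x y. \<sigma> x < \<sigma> y) T D lt"
        unfolding Emb_diversity[OF A' C'] Emb_diversity[OF B' C'] vC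
        using \<rho>(2) \<sigma>(2) ordC by (auto intro!: ordered_embeddings_cong)
      \<comment> \<open>The values of \<open>\<chi>\<close> are known only on embeddings; truncation
        at \<open>1\<close> bounds it everywhere and changes nothing there.\<close>
      obtain f c where f: "f \<in> Emb ?L B C" and c: "\<And>e. e \<in> Emb ?L A B \<Longrightarrow> min 1 (\<chi> (compose (verts A) f e)) = c"
        using ramsey[rule_format, of "\<lambda>f. min 1 (\<chi> f)"] unfolding EmbC EmbAB by auto
      have "\<chi> (compose (verts A) f e) = c" if e: "e \<in> Emb ?L A B" for e
      proof -
        have "compose (verts A) f e \<in> Emb ?L A C"
          using e f ordered_embeddings_compose unfolding EmbAB EmbC by blast
        then have "\<chi> (compose (verts A) f e) \<in> {0, 1}" using \<chi> by auto
        then show ?thesis using c[OF e] by auto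
      qed
      then show ?thesis using f by blast
    qed
    ultimately show ?thesis by blast
  qed
qed

end
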